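(* (1) For every special $\Pi^0_1$ set $P\subseteq2^{\mathbb N}$, we have $\bigtriangledown P<^{<\omega}_1P$ and $P\equiv^1_\omega\bigtriangledown P$. (2) For every special $\Pi^0_1$ set $P\subseteq2^{\mathbb N}$ there exists a $\Pi^0_1$ set $Q\subseteq2^{\mathbb N}$ with $Q<^{<\omega}_1P$ and $P\equiv^1_\omega Q$.
   Context: A set is special if it is nonempty and contains no computable element. With each $\Pi^0_1$ set $P\subseteq2^{\mathbb N}$ (given by an index) a corresponding computable tree $T_P\subseteq2^{<\mathbb N}$ whose set of infinite paths is $P$ is fixed; $L_P$ is the set of leaves (dead ends) of $T_P$. The concatenation is $P^\frown Q=P\cup\bigcup_{\rho\in L_P}\rho^\frown Q$ where $\rho^\frown Q=\{\rho^\frown f:f\in Q\}$, and $\bigtriangledown P=\bigcup_{n\in\mathbb N}(P^\frown\cdots{}^\frown P)$, where the $n$-th term is the iterated concatenation of $n+1$ copies of $P$; equivalently, $\bigtriangledown P=\{\rho_1{}^\frown\cdots{}^\frown\rho_k{}^\frown f:k\ge0,\ \rho_1,\dots,\rho_k\in L_P,\ f\in P\}$. Let $\{\Phi_e\}_{e\in\mathbb N}$ be an effective enumeration of all partial computable functions $\Phi_e:\subseteq\mathbb N^{\mathbb N}\to\mathbb N^{\mathbb N}$. A learner is a total computable function $\Psi:\mathbb N^{<\mathbb N}\to\mathbb N$. A partial function $\Gamma:\subseteq\mathbb N^{\mathbb N}\to\mathbb N^{\mathbb N}$ is $(<\omega,1)$-computable if there is $b\in\mathbb N$ such that for every $g\in\mathrm{dom}(\Gamma)$,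 $\Gamma(g)=\Phi_e(g)$ for some $e<b$. It is $(1,\omega)$-computable if there is a learner $\Psi$ such that for every $g\in\mathrm{dom}(\Gamma)$ the limit $\lim_n\Psi(g\upharpoonright n)$ exists and $\Phi_{\lim_n\Psi(g\upharpoonright n)}(g)=\Gamma(g)$. For $A,B\subseteq\mathbb N^{\mathbb N}$, $A\le^\alpha_\beta B$ means there is an $(\alpha,\beta)$-computable $\Gamma$ with $B\subseteq\mathrm{dom}(\Gamma)$ and $\Gamma(g)\in A$ for every $g\in B$. $A<^\alpha_\beta B$ means $A\le^\alpha_\beta B$ and $B\not\le^\alpha_\beta A$; $A\equiv^\alpha_\beta B$ means both reductions hold. *)

theory Defs
  imports Complex_Main "HOL-Library.Nat_Bijection" "HOL-Library.Omega_Words_Fun"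
begin

section \<open>Computability with an oracle\<close>

text \<open>
  Kleene's partial recursive functions relative to an oracle \<open>g\<close>, in the unary presentation:
  all functions have type \<open>nat \<rightharpoonup> nat\<close>, and several arguments are passed as one number
  via \<open>prod_encode\<close>.
\<close>

datatype prog =
    Zero | Succ | Fst | Snd | Oracle
  | Pair prog prog | Comp prog prog | Prec prog prog | Mu prog

definition minimize :: "(nat \<rightharpoonup> nat) \<Rightarrow> nat option" where
  "minimize h =
     (if \<exists>k. h k = Some 0 \<and> (\<forall>j<k. h j \<noteq> None)
      then Some (LEAST k. h k = Some 0) else None)"

primrec eval :: "(nat \<Rightarrow> nat) \<Rightarrow> prog \<Rightarrow> nat \<rightharpoonup> nat" where
  "eval g Zero = (\<lambda>n. Some 0)"
| "eval g Succ = (\<lambda>n. Some (Suc n))"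
| "eval g Fst = (\<lambda>n. Some (fst (prod_decode n)))"
| "eval g Snd = (\<lambda>n. Some (snd (prod_decode n)))"
| "eval g Oracle = (\<lambda>n. Some (g n))"
| "eval g (Pair p q) =
     (\<lambda>n. Option.bind (eval g p n) (\<lambda>x. Option.bind (eval g q n) (\<lambda>y. Some (prod_encode (x, y)))))"
| "eval g (Comp p q) = (\<lambda>n. Option.bind (eval g q n) (eval g p))"
| "eval g (Prec p q) =
     (\<lambda>n. case prod_decode n of (a, k) \<Rightarrow>
        rec_nat (eval g p a)
          (\<lambda>i r. Option.bind r (\<lambda>z. eval g q (prod_encode (a, prod_encode (i, z))))) k)"
| "eval g (Mu p) = (\<lambda>n. minimize (\<lambda>k. eval g p (prod_encode (n, k))))"

primrec godel :: "prog \<Rightarrow> nat" where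
  "godel Zero = 0"
| "godel Succ = 1"
| "godel Fst = 2"
| "godel Snd = 3"
| "godel Oracle = 4"
| "godel (Pair p q) = 5 + 4 * prod_encode (godel p, godel q)"
| "godel (Comp p q) = 6 + 4 * prod_encode (godel p, godel q)"
| "godel (Prec p q) = 7 + 4 * prod_encode (godel p, godel q)"
| "godel (Mu p) = 8 + 4 * godel p"

lemma inj_godel: "inj godel"
proof (rule injI)
  fix p q show "godel p = godel q \<Longrightarrow> p = q"
  proof (induction p arbitrary: q)
    case Zero then show ?case by (cases q) auto
  next
    case Succ then show ?case by (cases q) auto
  next
    case Fst then show ?case by (cases q) auto
  next
    case Snd then show ?case by (cases q) auto
  next
    case Oracle then show ?case by (cases q) auto
  next
    case (Pair p1 p2) then show ?case by (cases q) (simp_all, presburger+)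
  next
    case (Comp p1 p2) then show ?case by (cases q) (simp_all, presburger+)
  next
    case (Prec p1 p2) then show ?case by (cases q) (simp_all, presburger+)
  next
    case (Mu p) then show ?case by (cases q) (simp_all, presburger+)
  qed
qed

lemma surj_godel: "surj godel"
proof -
  have "\<exists>p. godel p = n" for n
  proof (induction n rule: less_induct)
    case (less n)
    show ?case
    proof (cases "n < 5")
      case True
      then consider "n = 0" | "n = 1" | "n = 2" | "n = 3" | "n = 4" by linarith
      then show ?thesis by cases (metis godel.simps)+
    next
      case False
      define m where "m = (n - 5) div 4"
      obtain a b where ab: "m = prod_encode (a, b)"
        by (metis prod_decode_inverse surj_pair)
      have "m < n" using False by (simp add: m_def)
      then have "a < n" "b < n"
        using ab le_prod_encode_1[of a b] le_prod_encode_2[of b a] by linarith+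
      then obtain p q r where "godel p = a" "godel q = b" "godel r = m"
        using less.IH \<open>m < n\<close> by blast
      moreover have "n = 5 + 4 * m \<or> n = 6 + 4 * m \<or> n = 7 + 4 * m \<or> n = 8 + 4 * m"
        using False unfolding m_def by presburger
      ultimately show ?thesis
        using ab godel.simps(6-9) by metis
    qed
  qed
  then show ?thesis by (metis surjI)
qed

definition prog_of :: "nat \<Rightarrow> prog" where
  "prog_of = inv godel"

lemma prog_of_godel [simp]: "prog_of (godel p) = p"
  by (simp add: prog_of_def inj_godel)

lemma godel_prog_of [simp]: "godel (prog_of e) = e"
  by (simp add: prog_of_def surj_godel surj_f_inv_f)

text \<open>
  The \<open>e\<close>-th partial computable function on Baire space; it is defined at \<open>g\<close> iff
  the program halts on every input with oracle \<open>g\<close>.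
\<close>

definition Phi :: "nat \<Rightarrow> (nat \<Rightarrow> nat) \<rightharpoonup> (nat \<Rightarrow> nat)" where
  "Phi e g =
     (if \<forall>n. eval g (prog_of e) n \<noteq> None then Some (\<lambda>n. the (eval g (prog_of e) n)) else None)"

text \<open>Plain computability is computability relative to the constant zero oracle.\<close>

definition computable :: "(nat \<Rightarrow> nat) \<Rightarrow> bool" where
  "computable f \<longleftrightarrow> (\<exists>p. \<forall>n. eval (\<lambda>_. 0) p n = Some (f n))"

definition computable_on_strings :: "(nat list \<Rightarrow> nat) \<Rightarrow> bool" where
  "computable_on_strings F \<longleftrightarrow> computable (\<lambda>n. F (list_decode n))"


section \<open>Trees and effectively closed sets\<close>

definition cantor :: "(nat \<Rightarrow> nat) set" where
  "cantor = {f. range f \<subseteq> {0, 1}}"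

definition computable_tree :: "nat list set \<Rightarrow> bool" where
  "computable_tree T \<longleftrightarrow>
     T \<subseteq> lists {0, 1} \<and> (\<forall>\<sigma> \<tau>. \<sigma> @ \<tau> \<in> T \<longrightarrow> \<sigma> \<in> T) \<and>
     computable_on_strings (\<lambda>\<sigma>. if \<sigma> \<in> T then 1 else 0)"

definition paths :: "nat list set \<Rightarrow> (nat \<Rightarrow> nat) set" where
  "paths T = {f \<in> cantor. \<forall>n. f [0 \<rightarrow> n] \<in> T}"

definition leaves :: "nat list set \<Rightarrow> nat list set" where
  "leaves T = {\<sigma> \<in> T. \<forall>\<tau>. \<sigma> @ \<tau> \<in> T \<longrightarrow> \<tau> = []}"

definition pi01 :: "(nat \<Rightarrow> nat) set \<Rightarrow> bool" where
  "pi01 P \<longleftrightarrow> (\<exists>T. computable_tree T \<and> paths T = P)"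

definition special :: "(nat \<Rightarrow> nat) set \<Rightarrow> bool" where
  "special P \<longleftrightarrow> P \<noteq> {} \<and> (\<forall>f\<in>P. \<not> computable f)"


section \<open>Concatenation\<close>

text \<open>
  The concatenation of \<open>P\<close> and \<open>Q\<close> depends on the tree chosen for \<open>P\<close>, so the operations
  below take a tree \<open>T\<close> with \<open>P = paths T\<close> as argument.
\<close>

definition concatenation :: "nat list set \<Rightarrow> (nat \<Rightarrow> nat) set \<Rightarrow> (nat \<Rightarrow> nat) set" where
  "concatenation T Q = paths T \<union> (\<Union>\<rho>\<in>leaves T. (\<lambda>f. \<rho> \<frown> f) ` Q)"

primrec iterated_concatenation :: "nat list set \<Rightarrow> nat \<Rightarrow> (nat \<Rightarrow> nat) set" where
  "iterated_concatenation T 0 = paths T"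
| "iterated_concatenation T (Suc n) = concatenation T (iterated_concatenation T n)"

definition nabla :: "nat list set \<Rightarrow> (nat \<Rightarrow> nat) set" where
  "nabla T = (\<Union>n. iterated_concatenation T n)"

lemma nabla_eq: "nabla T = {concat \<rho>s \<frown> f | \<rho>s f. set \<rho>s \<subseteq> leaves T \<and> f \<in> paths T}"
proof -
  have *: "iterated_concatenation T n =
      {concat \<rho>s \<frown> f | \<rho>s f. length \<rho>s \<le> n \<and> set \<rho>s \<subseteq> leaves T \<and> f \<in> paths T}" for n
  proof (induction n)
    case 0
    show ?case by auto
  next
    case (Suc n)
    show ?case (is "?L = ?R")
    proof (intro equalityI subsetI)
      fix g assume "g \<in> ?L"
      then consider "g \<in> paths T"
        | \<rho> \<rho>s f where "\<rho> \<in> leaves T" "length \<rho>s \<le> n" "set \<rho>s \<subseteq> leaves T" "f \<in> paths T"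
            "g = \<rho> \<frown> concat \<rho>s \<frown> f"
        by (auto simp: concatenation_def Suc.IH)
      then show "g \<in> ?R"
      proof cases
        case 1
        then show ?thesis by (auto intro!: exI[of _ "[]"])
      next
        case (2 \<rho> \<rho>s f)
        then show ?thesis by (auto intro!: exI[of _ "\<rho> # \<rho>s"] exI[of _ f])
      qed
    next
      fix g assume "g \<in> ?R"
      then obtain \<rho>s f where g: "length \<rho>s \<le> Suc n" "set \<rho>s \<subseteq> leaves T" "f \<in> paths T"
        "g = concat \<rho>s \<frown> f" by blast
      show "g \<in> ?L"
      proof (cases \<rho>s)
        case Nil
        then show ?thesis using g by (simp add: concatenation_def)
      next
        case (Cons \<rho> \<rho>s')
        then have "concat \<rho>s' \<frown> f \<in> iterated_concatenation T n" "\<rho> \<in> leaves T"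
          using g unfolding Suc.IH by auto
        moreover have "g = \<rho> \<frown> (concat \<rho>s' \<frown> f)" using g Cons by simp
        ultimately show ?thesis by (auto simp only: iterated_concatenation.simps concatenation_def)
      qed
    qed
  qed
  show ?thesis unfolding nabla_def * by auto
qed


section \<open>Nonuniform reducibilities\<close>

definition finite_one_computable :: "((nat \<Rightarrow> nat) \<rightharpoonup> (nat \<Rightarrow> nat)) \<Rightarrow> bool" where
  "finite_one_computable \<Gamma> \<longleftrightarrow> (\<exists>b. \<forall>g\<in>dom \<Gamma>. \<exists>e<b. \<Gamma> g = Phi e g)"

definition one_omega_computable :: "((nat \<Rightarrow> nat) \<rightharpoonup> (nat \<Rightarrow> nat)) \<Rightarrow> bool" where
  "one_omega_computable \<Gamma> \<longleftrightarrow>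
     (\<exists>\<Psi>. computable_on_strings \<Psi> \<and>
        (\<forall>g\<in>dom \<Gamma>. \<exists>e. (\<lambda>n. \<Psi> (g [0 \<rightarrow> n])) \<longlonglongrightarrow> e \<and> Phi e g = \<Gamma> g))"

text \<open>\<open>C\<close> is the class of partial functions admitted as reductions.\<close>

definition reducible ::
    "(((nat \<Rightarrow> nat) \<rightharpoonup> (nat \<Rightarrow> nat)) \<Rightarrow> bool) \<Rightarrow> (nat \<Rightarrow> nat) set \<Rightarrow> (nat \<Rightarrow> nat) set \<Rightarrow> bool" where
  "reducible C A B \<longleftrightarrow> (\<exists>\<Gamma>. C \<Gamma> \<and> B \<subseteq> dom \<Gamma> \<and> (\<forall>g\<in>B. the (\<Gamma> g) \<in> A))"

definition strictly_reducible ::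
    "(((nat \<Rightarrow> nat) \<rightharpoonup> (nat \<Rightarrow> nat)) \<Rightarrow> bool) \<Rightarrow> (nat \<Rightarrow> nat) set \<Rightarrow> (nat \<Rightarrow> nat) set \<Rightarrow> bool" where
  "strictly_reducible C A B \<longleftrightarrow> reducible C A B \<and> \<not> reducible C B A"

definition equi_reducible ::
    "(((nat \<Rightarrow> nat) \<rightharpoonup> (nat \<Rightarrow> nat)) \<Rightarrow> bool) \<Rightarrow> (nat \<Rightarrow> nat) set \<Rightarrow> (nat \<Rightarrow> nat) set \<Rightarrow> bool" where
  "equi_reducible C A B \<longleftrightarrow> reducible C A B \<and> reducible C B A"

end

theory Submission
  imports Defs
begin

text \<open>
  A learner can reduce \<open>P\<close> to \<open>\<nabla>P\<close>: it parses its input greedily into leaves and guesses that the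
  last cut found is the final one. For the negative part, a class \<open>Q\<close> with \<open>P \<subseteq> Q \<subseteq> \<nabla>P\<close> is built that
  is \<open>\<Pi>\<^sup>0\<^sub>1\<close>, unlike \<open>\<nabla>P\<close>; it settles both parts. After the first leaf, of length \<open>b\<close> say, an
  element of \<open>Q\<close> may pass from a concatenation \<open>\<beta>\<close> of leaves to \<open>\<beta>\<rho>\<close> only for the least leaf \<open>\<rho>\<close>
  for which some \<open>\<Phi>\<^sub>e\<close> with \<open>e < b\<close> is seen to map \<open>\<beta>\<rho>\<close> to a node of the tree of length \<open>|\<beta>|\<close>.
  Infinitely many such steps would define a computable sequence on which one of these \<open>\<Phi>\<^sub>e\<close> is total
  with value in \<open>P\<close>, contradicting specialness. Hence \<open>Q \<subseteq> \<nabla>P\<close>, and from every first leaf some \<open>\<beta>\<close>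
  without a further step is reached. Then no \<open>\<Phi>\<^sub>e\<close> with \<open>e < b\<close> maps an element of \<open>\<beta>\<frown>P \<subseteq> Q\<close>
  into \<open>P\<close>: otherwise a long prefix of it, extended to a leaf, would permit one more step.
\<close>


subsection \<open>Closure properties of computability\<close>

abbreviation "p1 n \<equiv> fst (prod_decode n)"
abbreviation "p2 n \<equiv> snd (prod_decode n)"

abbreviation decidable :: "(nat \<Rightarrow> bool) \<Rightarrow> bool" where
  "decidable P \<equiv> computable (\<lambda>x. of_bool (P x))"

abbreviation computable_list :: "(nat \<Rightarrow> nat list) \<Rightarrow> bool" where
  "computable_list f \<equiv> computable (\<lambda>x. list_encode (f x))"

named_theorems computable_intros

lemma computable_comp:
  assumes "computable f" "computable g"
  shows "computable (\<lambda>x. f (g x))"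
proof -
  obtain p q where "\<forall>n. eval (\<lambda>_. 0) p n = Some (f n)" "\<forall>n. eval (\<lambda>_. 0) q n = Some (g n)"
    using assms unfolding computable_def by blast
  then have "\<forall>n. eval (\<lambda>_. 0) (Comp p q) n = Some (f (g n))" by simp
  then show ?thesis unfolding computable_def by blast
qed

lemma computable_pair [computable_intros]:
  assumes "computable f" "computable g"
  shows "computable (\<lambda>x. prod_encode (f x, g x))"
proof -
  obtain p q where "\<forall>n. eval (\<lambda>_. 0) p n = Some (f n)" "\<forall>n. eval (\<lambda>_. 0) q n = Some (g n)"
    using assms unfolding computable_def by blast
  then have "\<forall>n. eval (\<lambda>_. 0) (Pair p q) n = Some (prod_encode (f n, g n))" by simp
  then show ?thesis unfolding computable_def by blast
qed

lemma computable_p1 [computable_intros]: "computable f \<Longrightarrow> computable (\<lambda>x. p1 (f x))"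
proof -
  have "\<forall>n. eval (\<lambda>_. 0) Fst n = Some (p1 n)" by simp
  then show "computable f \<Longrightarrow> ?thesis"
    using computable_comp[of p1 f] unfolding computable_def by blast
qed

lemma computable_p2 [computable_intros]: "computable f \<Longrightarrow> computable (\<lambda>x. p2 (f x))"
proof -
  have "\<forall>n. eval (\<lambda>_. 0) Snd n = Some (p2 n)" by simp
  then show "computable f \<Longrightarrow> ?thesis"
    using computable_comp[of p2 f] unfolding computable_def by blast
qed

lemma computable_Suc [computable_intros]: "computable f \<Longrightarrow> computable (\<lambda>x. Suc (f x))"
proof -
  have "\<forall>n. eval (\<lambda>_. 0) Succ n = Some (Suc n)" by simp
  then show "computable f \<Longrightarrow> ?thesis"
    using computable_comp[of Suc f] unfolding computable_def by blast
qed

lemma computable_id [computable_intros]: "computable (\<lambda>x. x)"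
proof -
  have "\<forall>n. eval (\<lambda>_. 0) (Pair Fst Snd) n = Some n" by simp
  then show ?thesis unfolding computable_def by blast
qed

lemma computable_const [computable_intros]: "computable (\<lambda>_. c)"
proof (induction c)
  case 0
  have "\<forall>n. eval (\<lambda>_. 0) Zero n = Some 0" by simp
  then show ?case unfolding computable_def by blast
next
  case (Suc c)
  then show ?case by (rule computable_Suc)
qed

lemma computable_comp2:
  assumes "computable (\<lambda>y. h (p1 y) (p2 y))" "computable f" "computable g"
  shows "computable (\<lambda>x. h (f x) (g x))"
  using computable_comp[OF assms(1) computable_pair[OF assms(2,3)]] by simp

lemma computable_rec [computable_intros]:
  assumes b: "computable b" and s: "computable (\<lambda>y. s (p1 y) (p1 (p2 y)) (p2 (p2 y)))"
    and k: "computable k"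
  shows "computable (\<lambda>x. rec_nat (b x) (s x) (k x))"
proof -
  obtain p where p: "\<And>n. eval (\<lambda>_. 0) p n = Some (b n)" using b unfolding computable_def by blast
  obtain q where q: "\<And>n. eval (\<lambda>_. 0) q n = Some (s (p1 n) (p1 (p2 n)) (p2 (p2 n)))"
    using s unfolding computable_def by blast
  have "eval (\<lambda>_. 0) (Prec p q) (prod_encode (x, n)) = Some (rec_nat (b x) (s x) n)" for x n
    by (induction n) (simp_all add: p q)
  then have "\<forall>y. eval (\<lambda>_. 0) (Prec p q) y = Some (rec_nat (b (p1 y)) (s (p1 y)) (p2 y))"
    by (metis prod.collapse prod_decode_inverse)
  then have "computable (\<lambda>y. rec_nat (b (p1 y)) (s (p1 y)) (p2 y))"
    unfolding computable_def by blast
  from computable_comp2[OF this computable_id k] show ?thesis .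
qed

lemma computable_if [computable_intros]:
  assumes "decidable P" "computable f" "computable g"
  shows "computable (\<lambda>x. if P x then f x else g x)"
proof -
  \<comment> \<open>A recursion of length 0 or 1 makes the case distinction.\<close>
  have "computable (\<lambda>x. rec_nat (g x) (\<lambda>_ _. f x) (of_bool (P x)))"
    using assms by (intro computable_rec computable_comp[OF assms(2)] computable_p1 computable_id)
  moreover have "rec_nat (g x) (\<lambda>_ _. f x) (of_bool (P x)) = (if P x then f x else g x)" for x
    by simp
  ultimately show ?thesis by simp
qed

lemma computable_add [computable_intros]:
  assumes "computable f" "computable g"
  shows "computable (\<lambda>x. f x + g x)"
proof -
  have "computable (\<lambda>x. rec_nat (f x) (\<lambda>_ r. Suc r) (g x))"
    by (intro computable_intros assms)
  moreover have "rec_nat a (\<lambda>_ r. Suc r) b = a + b" for a b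
    by (induction b) auto
  ultimately show ?thesis by simp
qed

lemma computable_mult [computable_intros]:
  assumes "computable f" "computable g"
  shows "computable (\<lambda>x. f x * g x)"
proof -
  have "computable (\<lambda>x. rec_nat 0 (\<lambda>_ r. f x + r) (g x))"
    by (intro computable_intros computable_comp[OF assms(1)] assms)
  moreover have "rec_nat 0 (\<lambda>_ r. a + r) b = a * b" for a b :: nat
    by (induction b) auto
  ultimately show ?thesis by simp
qed

lemma computable_minus [computable_intros]:
  assumes "computable f" "computable g"
  shows "computable (\<lambda>x. f x - g x)"
proof -
  have pred: "computable (\<lambda>x. x - 1)"
  proof -
    \<comment> \<open>The recursion returns its counter and forgets the previous value; its last
      counter is the predecessor.\<close>
    have "computable (\<lambda>x. rec_nat 0 (\<lambda>i _. i) x)"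
      by (intro computable_intros)
    moreover have "rec_nat 0 (\<lambda>i _. i) x = x - 1" for x
      by (cases x) auto
    ultimately show ?thesis by simp
  qed
  have "computable (\<lambda>x. rec_nat (f x) (\<lambda>_ r. r - 1) (g x))"
    by (intro computable_intros assms computable_comp[OF pred])
  moreover have "rec_nat a (\<lambda>_ r. r - 1) b = a - b" for a b :: nat
    by (induction b) auto
  ultimately show ?thesis by simp
qed

lemma decidable_not [computable_intros]:
  assumes "decidable P"
  shows "decidable (\<lambda>x. \<not> P x)"
proof -
  have "of_bool (\<not> P x) = 1 - (of_bool (P x) :: nat)" for x by simp
  moreover have "computable (\<lambda>x. 1 - of_bool (P x))" by (intro computable_intros assms)
  ultimately show ?thesis by (simp only:)
qed

lemma decidable_conj [computable_intros]:
  assumes "decidable P" "decidable Q"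
  shows "decidable (\<lambda>x. P x \<and> Q x)"
proof -
  have "of_bool (P x \<and> Q x) = (of_bool (P x) * of_bool (Q x) :: nat)" for x by simp
  then show ?thesis using computable_mult[OF assms] by simp
qed

lemma decidable_disj [computable_intros]:
  assumes "decidable P" "decidable Q"
  shows "decidable (\<lambda>x. P x \<or> Q x)"
  using decidable_not[OF decidable_conj[OF assms[THEN decidable_not]]] by simp

lemma decidable_imp [computable_intros]:
  assumes "decidable P" "decidable Q"
  shows "decidable (\<lambda>x. P x \<longrightarrow> Q x)"
  using decidable_disj[OF decidable_not[OF assms(1)] assms(2)] by (simp only: imp_conv_disj)

lemma decidable_le [computable_intros]:
  assumes "computable f" "computable g"
  shows "decidable (\<lambda>x. f x \<le> g x)"
proof -
  have "of_bool (f x \<le> g x) = 1 - (f x - g x)" for x by auto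
  moreover have "computable (\<lambda>x. 1 - (f x - g x))" by (intro computable_intros assms)
  ultimately show ?thesis by simp
qed

lemma decidable_less [computable_intros]:
  assumes "computable f" "computable g"
  shows "decidable (\<lambda>x. f x < g x)"
  using decidable_not[OF decidable_le[OF assms(2,1)]] by (simp add: not_le)

lemma decidable_eq [computable_intros]:
  assumes "computable f" "computable g"
  shows "decidable (\<lambda>x. f x = g x)"
  using decidable_conj[OF decidable_le[OF assms] decidable_le[OF assms(2,1)]]
  by (simp only: order.eq_iff[where 'a = nat])

lemma decidable_ex_less [computable_intros]:
  assumes "decidable (\<lambda>y. P (p1 y) (p2 y))" "computable k"
  shows "decidable (\<lambda>x. \<exists>i<k x. P x i)"
proof -
  have "computable (\<lambda>x. rec_nat 0 (\<lambda>i r. if P x i then 1 else r) (k x))"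
    by (intro computable_intros assms computable_comp2[OF assms(1)])
  moreover have "rec_nat 0 (\<lambda>i r. if P x i then 1 else r) n = (of_bool (\<exists>i<n. P x i) :: nat)" for x n
    by (induction n) (auto simp: less_Suc_eq)
  ultimately show ?thesis by simp
qed

lemma decidable_all_less [computable_intros]:
  assumes "decidable (\<lambda>y. P (p1 y) (p2 y))" "computable k"
  shows "decidable (\<lambda>x. \<forall>i<k x. P x i)"
  using decidable_not[OF decidable_ex_less[where P = "\<lambda>x i. \<not> P x i",
    OF decidable_not[OF assms(1)] assms(2)]] by simp

text \<open>Truth is coded by 1 while \<open>minimize\<close> looks for a zero, hence the
  negation.\<close>

lemma minimize_Least:
  assumes "\<And>k. h k = Some (of_bool (\<not> P k))" "\<exists>k. P k"
  shows "minimize h = Some (LEAST k. P k)"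
proof -
  have "h k = Some 0 \<longleftrightarrow> P k" for k using assms(1)[of k] by simp
  then show ?thesis using assms by (auto simp: minimize_def)
qed

lemma computable_Least [computable_intros]:
  assumes "decidable (\<lambda>y. P (p1 y) (p2 y))" "\<And>x. \<exists>n. P x n"
  shows "computable (\<lambda>x. LEAST n. P x n)"
proof -
  obtain p where p: "\<And>y. eval (\<lambda>_. 0) p y = Some (of_bool (\<not> P (p1 y) (p2 y)))"
    using decidable_not[OF assms(1)] unfolding computable_def by blast
  have "eval (\<lambda>_. 0) (Mu p) x = Some (LEAST n. P x n)" for x
    using assms(2) by (simp add: minimize_Least[where P = "P x"] p)
  then show ?thesis unfolding computable_def by blast
qed

text \<open>Unlike in \<open>computable_Least\<close>, the search is only known to succeed along the orbit.\<close>

lemma computable_iterate_Least: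
  assumes R: "decidable (\<lambda>y. R (p1 y) (p2 y))"
    and ex: "\<And>j. \<exists>y. R (s j) y" and step: "\<And>j. s (Suc j) = (LEAST y. R (s j) y)"
  shows "computable s"
proof -
  obtain p where p: "\<And>y. eval (\<lambda>_. 0) p y = Some (of_bool (\<not> R (p1 y) (p2 y)))"
    using decidable_not[OF R] unfolding computable_def by blast
  obtain b where b: "\<And>n. eval (\<lambda>_. 0) b n = Some (s 0)"
    using computable_const unfolding computable_def by blast
  obtain i where i: "\<And>n. eval (\<lambda>_. 0) i n = Some (p2 (p2 n))"
    using computable_p2[OF computable_p2[OF computable_id]] unfolding computable_def by blast
  have mu: "eval (\<lambda>_. 0) (Mu p) (s j) = Some (s (Suc j))" for j
    unfolding step using ex by (simp add: minimize_Least[where P = "R (s j)"] p)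
  have "eval (\<lambda>_. 0) (Prec b (Comp (Mu p) i)) (prod_encode (x, n)) = Some (s n)" for x n
    using mu by (induction n) (simp_all add: b i)
  \<comment> \<open>\<open>Pair Fst Snd\<close> is the identity, so \<open>n\<close> is passed as
    the counter of the recursion, with 0 as a dummy parameter.\<close>
  then have "eval (\<lambda>_. 0) (Comp (Prec b (Comp (Mu p) i)) (Pair Zero (Pair Fst Snd))) n = Some (s n)" for n
    by simp
  then show ?thesis unfolding computable_def by blast
qed

subsection \<open>Lists\<close>

lemma prod_decode_0: "prod_decode 0 = (0, 0)"
  unfolding prod_decode_def by (subst prod_decode_aux.simps) simp

text \<open>The code of a nonempty list is the successor of a pair. For the empty list, truncated
  subtraction and \<open>prod_decode_0\<close> give 0 again.\<close>

lemma list_encode_tl: "list_encode (tl xs) = p2 (list_encode xs - 1)"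
  by (cases xs) (simp_all add: prod_decode_0)

text \<open>Appending zeros makes lookup in a list total; beyond the end both sides are 0.\<close>

lemma list_encode_nth: "(xs \<frown> (\<lambda>_. 0)) i = p1 (list_encode (drop i xs) - 1)"
proof (cases "i < length xs")
  case True
  then show ?thesis by (simp add: Cons_nth_drop_Suc[symmetric])
qed (simp add: prod_decode_0)

lemma computable_list_decode [computable_intros]:
  "computable f \<Longrightarrow> computable_list (\<lambda>x. list_decode (f x))"
  by simp

lemma computable_drop [computable_intros]:
  assumes "computable_list f" "computable k"
  shows "computable_list (\<lambda>x. drop (k x) (f x))"
proof -
  have "computable (\<lambda>x. rec_nat (list_encode (f x)) (\<lambda>_ r. p2 (r - 1)) (k x))"
    by (intro computable_intros assms)
  moreover have "rec_nat (list_encode xs) (\<lambda>_ r. p2 (r - 1)) n = list_encode (drop n xs)" for xs n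
    by (induction n) (simp_all add: drop_Suc drop_tl list_encode_tl)
  ultimately show ?thesis by simp
qed

lemma computable_nth [computable_intros]:
  assumes "computable_list f" "computable k"
  shows "computable (\<lambda>x. (f x \<frown> (\<lambda>_. 0)) (k x))"
  unfolding list_encode_nth by (intro computable_intros assms)

lemma list_encode_eq_0: "list_encode xs = 0 \<longleftrightarrow> xs = []"
  by (cases xs) auto

lemma computable_length [computable_intros]:
  assumes "computable_list f"
  shows "computable (\<lambda>x. length (f x))"
proof -
  \<comment> \<open>The length is the least number of entries whose removal leaves the empty list,
    which has code 0.\<close>
  have "computable (\<lambda>n. LEAST k. list_encode (drop k (list_decode n)) = 0)"
    by (intro computable_intros) (auto simp: list_encode_eq_0)
  from computable_comp[OF this assms]
  have "computable (\<lambda>x. LEAST k. length (f x) \<le> k)"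
    by (simp add: list_encode_eq_0)
  moreover have "(LEAST k. n \<le> k) = n" for n :: nat by (rule Least_equality) auto
  ultimately show ?thesis by simp
qed

lemma decidable_list_eq [computable_intros]:
  assumes "computable_list f" "computable_list g"
  shows "decidable (\<lambda>x. f x = g x)"
  using decidable_eq[OF assms] by (simp add: inj_eq[OF inj_list_encode])

text \<open>Unbounded search finds the only list with the right length and the right
  entries.\<close>

lemma computable_subsequence [computable_intros]:
  assumes h: "computable (\<lambda>y. h (p1 y) (p2 y))" and m: "computable m" and n: "computable n"
  shows "computable_list (\<lambda>x. subsequence (h x) (m x) (n x))"
proof -
  define G where "G x z \<longleftrightarrow> length (list_decode z) = n x - m x \<and>
    (\<forall>i<n x - m x. (list_decode z \<frown> (\<lambda>_. 0)) i = h x (m x + i))" for x z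
  have "decidable (\<lambda>y. G (p1 y) (p2 y))" unfolding G_def
    by (intro computable_intros computable_comp[OF m] computable_comp[OF n] computable_comp2[OF h])
  moreover have G: "G x z \<longleftrightarrow> z = list_encode (subsequence (h x) (m x) (n x))" for x z
  proof
    assume "G x z"
    then have "list_decode z = subsequence (h x) (m x) (n x)"
      unfolding G_def by (intro nth_equalityI) auto
    then show "z = list_encode (subsequence (h x) (m x) (n x))" by (metis list_decode_inverse)
  qed (simp add: G_def)
  ultimately have "computable (\<lambda>x. LEAST z. G x z)"
    by (intro computable_Least) auto
  moreover have "(LEAST z. z = c) = c" for c :: nat by (rule Least_equality) auto
  ultimately show ?thesis by (simp only: G)
qed

lemma computable_append [computable_intros]:
  assumes "computable_list f" "computable_list g"
  shows "computable_list (\<lambda>x. f x @ g x)"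
proof -
  define h where "h x i = (if i < length (f x) then (f x \<frown> (\<lambda>_. 0)) i
      else (g x \<frown> (\<lambda>_. 0)) (i - length (f x)))" for x i
  have "computable_list (\<lambda>x. subsequence (h x) 0 (length (f x) + length (g x)))" unfolding h_def
    by (intro computable_intros assms computable_comp[OF assms(1)] computable_comp[OF assms(2)])
  moreover have "subsequence (h x) 0 (length (f x) + length (g x)) = f x @ g x" for x
    by (rule nth_equalityI) (auto simp: nth_append h_def)
  ultimately show ?thesis by simp
qed

lemma computable_take [computable_intros]:
  assumes "computable_list f" "computable k"
  shows "computable_list (\<lambda>x. take (k x) (f x))"
proof -
  \<comment> \<open>By truncated subtraction the upper end is the minimum of
    \<open>length (f x)\<close> and \<open>k x\<close>, so no padding is copied.\<close>
  have "computable_list (\<lambda>x. subsequence (f x \<frown> (\<lambda>_. 0)) 0 (length (f x) - (length (f x) - k x)))"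
    by (intro computable_intros assms computable_comp[OF assms(1)])
  moreover have "subsequence (xs \<frown> (\<lambda>_. 0)) 0 (length xs - (length xs - n)) = take n xs" for n and xs :: "nat list"
    by (rule nth_equalityI) auto
  ultimately show ?thesis by (simp only:)
qed

lemma decidable_list_ex [computable_intros]:
  assumes P: "decidable (\<lambda>y. P (p1 y) (p2 y))" and f: "computable_list f"
  shows "decidable (\<lambda>x. \<exists>t\<in>set (f x). P x t)"
proof -
  have "decidable (\<lambda>x. \<exists>i<length (f x). P x ((f x \<frown> (\<lambda>_. 0)) i))"
    by (intro computable_intros computable_comp[OF f] computable_comp2[OF P] f)
  moreover have "(\<exists>i<length xs. Q ((xs \<frown> (\<lambda>_. 0)) i)) \<longleftrightarrow> (\<exists>t\<in>set xs. Q t)" for Q and xs :: "nat list"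
    by (metis conc_fst in_set_conv_nth)
  ultimately show ?thesis by simp
qed

lemma decidable_list_all [computable_intros]:
  assumes P: "decidable (\<lambda>y. P (p1 y) (p2 y))" and f: "computable_list f"
  shows "decidable (\<lambda>x. \<forall>t\<in>set (f x). P x t)"
proof -
  have "decidable (\<lambda>x. \<not> (\<exists>t\<in>set (f x). \<not> P x t))"
    by (intro decidable_not decidable_list_ex f P)
  then show ?thesis by (simp only: bex_simps not_not)
qed

subsection \<open>Computations from strings\<close>

abbreviation "idx t \<equiv> p1 t"
abbreviation "arg t \<equiv> p1 (p2 t)"
abbreviation "val t \<equiv> p2 (p2 t)"

definition fact_code :: "nat \<Rightarrow> nat \<Rightarrow> nat \<Rightarrow> nat" where
  "fact_code e n v = prod_encode (e, prod_encode (n, v))"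

lemma fact_code_simps [simp]:
  "idx (fact_code e n v) = e" "arg (fact_code e n v) = n" "val (fact_code e n v) = v"
  by (simp_all add: fact_code_def)

text \<open>A number \<open>t\<close> codes the claim that program \<open>idx t\<close> returns \<open>val t\<close> on input \<open>arg t\<close>.
  The claim is justified if one step of the evaluation derives it from claims in \<open>C\<close>, with
  oracle queries answered by the string \<open>\<tau>\<close>.\<close>

definition justified :: "nat list \<Rightarrow> nat list \<Rightarrow> nat \<Rightarrow> bool" where
  "justified \<tau> C t \<longleftrightarrow>
     idx t = 0 \<and> val t = 0 \<or>
     idx t = 1 \<and> val t = Suc (arg t) \<or>
     idx t = 2 \<and> val t = p1 (arg t) \<or>
     idx t = 3 \<and> val t = p2 (arg t) \<or>
     idx t = 4 \<and> arg t < length \<tau> \<and> val t = (\<tau> \<frown> (\<lambda>_. 0)) (arg t) \<or>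
     (\<exists>r\<in>set C. \<exists>s\<in>set C. idx t = 5 + 4 * prod_encode (idx r, idx s) \<and>
        arg r = arg t \<and> arg s = arg t \<and> val t = prod_encode (val r, val s)) \<or>
     (\<exists>r\<in>set C. \<exists>s\<in>set C. idx t = 6 + 4 * prod_encode (idx s, idx r) \<and>
        arg r = arg t \<and> arg s = val r \<and> val t = val s) \<or>
     (\<exists>r\<in>set C. \<exists>q<idx t. idx t = 7 + 4 * prod_encode (idx r, q) \<and>
        arg t = prod_encode (arg r, 0) \<and> val t = val r) \<or>
     (\<exists>r\<in>set C. \<exists>s\<in>set C. \<exists>p<idx t. idx t = 7 + 4 * prod_encode (p, idx s) \<and>
        idx r = idx t \<and> arg t = prod_encode (p1 (arg r), Suc (p2 (arg r))) \<and>
        arg s = prod_encode (p1 (arg r), prod_encode (p2 (arg r), val r)) \<and> val t = val s) \<or>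
     (\<exists>r\<in>set C. idx t = 8 + 4 * idx r \<and> arg r = prod_encode (arg t, val t) \<and> val r = 0 \<and>
        (\<forall>j<val t. \<exists>s\<in>set C. idx s = idx r \<and> arg s = prod_encode (arg t, j) \<and> val s \<noteq> 0))"

text \<open>Derivations are listed backwards: each claim rests on those behind it, so a new
  conclusion is simply put in front.\<close>

definition certificate :: "nat list \<Rightarrow> nat list \<Rightarrow> bool" where
  "certificate \<tau> c \<longleftrightarrow>
     (\<forall>i<length c. justified \<tau> (drop (Suc i) c) ((c \<frown> (\<lambda>_. 0)) i))"

text \<open>Every quantifier in \<open>justified\<close> ranges over a list or below a number. The
  bounds by \<open>idx t\<close> lose nothing, since the index of a program exceeds those of its
  parts.\<close>

lemma decidable_justified [computable_intros]:
  assumes "computable_list f" "computable_list g" "computable h"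
  shows "decidable (\<lambda>x. justified (f x) (g x) (h x))"
  unfolding justified_def
  by (intro computable_intros assms[THEN computable_comp])

lemma decidable_certificate [computable_intros]:
  assumes "computable_list f" "computable_list g"
  shows "decidable (\<lambda>x. certificate (f x) (g x))"
  unfolding certificate_def
  by (intro computable_intros assms[THEN computable_comp] assms)

lemma certificate_Nil [simp]: "certificate \<tau> []"
  by (simp add: certificate_def)

lemma certificate_Cons [simp]:
  "certificate \<tau> (t # c) \<longleftrightarrow> justified \<tau> c t \<and> certificate \<tau> c"
  unfolding certificate_def by (simp add: All_less_Suc2)

text \<open>Claims from \<open>C\<close> occur only positively, and a longer oracle string keeps all
  answers of the shorter one.\<close>

lemma justified_mono:
  assumes "justified \<tau> C t" "set C \<subseteq> set C'"
  shows "justified (\<tau> @ \<upsilon>) C' t"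
proof -
  have *: "arg t < length (\<tau> @ \<upsilon>) \<and> val t = ((\<tau> @ \<upsilon>) \<frown> (\<lambda>_. 0)) (arg t)"
    if "arg t < length \<tau> \<and> val t = (\<tau> \<frown> (\<lambda>_. 0)) (arg t)"
    using that by (simp add: nth_append)
  show ?thesis using assms(1) unfolding justified_def
    by (elim disj_forward) (use * assms(2) in blast)+
qed

lemma certificate_append:
  "certificate \<tau> c \<Longrightarrow> certificate \<tau> d \<Longrightarrow> certificate \<tau> (c @ d)"
  using justified_mono[where \<upsilon> = "[]"] by (induction c) auto

lemma certificate_mono: "certificate \<tau> c \<Longrightarrow> certificate (\<tau> @ \<upsilon>) c"
  using justified_mono by (induction c) auto

lemma prog_of_simps [simp]:
  "prog_of 0 = Zero" "prog_of (Suc 0) = Succ" "prog_of 2 = Fst" "prog_of 3 = Snd" "prog_of 4 = Oracle"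
  "prog_of (5 + 4 * prod_encode (a, b)) = Pair (prog_of a) (prog_of b)"
  "prog_of (6 + 4 * prod_encode (a, b)) = Comp (prog_of a) (prog_of b)"
  "prog_of (7 + 4 * prod_encode (a, b)) = Prec (prog_of a) (prog_of b)"
  "prog_of (8 + 4 * a) = Mu (prog_of a)"
  by (metis godel.simps prog_of_godel godel_prog_of One_nat_def)+

section \<open>Soundness of certificates\<close>

abbreviation holds :: "(nat \<Rightarrow> nat) \<Rightarrow> nat \<Rightarrow> bool" where
  "holds g t \<equiv> eval g (prog_of (idx t)) (arg t) = Some (val t)"

lemma minimize_SomeI:
  assumes "h v = Some 0" "\<And>j. j < v \<Longrightarrow> \<exists>y. h j = Some y \<and> y \<noteq> 0"
  shows "minimize h = Some v"
proof -
  have "(LEAST k. h k = Some 0) = v"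
    using assms by (intro Least_equality) (metis not_less option.inject)+
  moreover have "\<exists>k. h k = Some 0 \<and> (\<forall>j<k. h j \<noteq> None)"
    using assms by (metis option.distinct(1))
  ultimately show ?thesis unfolding minimize_def by simp
qed

lemma minimize_SomeD:
  assumes "minimize h = Some v"
  shows "h v = Some 0" "\<And>j. j < v \<Longrightarrow> \<exists>y. h j = Some y \<and> y \<noteq> 0"
proof -
  obtain k where k: "h k = Some 0" "\<forall>j<k. h j \<noteq> None" and v: "v = (LEAST k. h k = Some 0)"
    using assms unfolding minimize_def by (auto split: if_splits)
  show "h v = Some 0" unfolding v by (rule LeastI) (rule k)
  fix j assume j: "j < v"
  have "v \<le> k" unfolding v by (rule Least_le) (rule k)
  then obtain y where "h j = Some y" using j k(2) by fastforce
  moreover have "h j \<noteq> Some 0" using not_less_Least[of j "\<lambda>k. h k = Some 0"] j v by simp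
  ultimately show "\<exists>y. h j = Some y \<and> y \<noteq> 0" by simp
qed

text \<open>Each clause of \<open>justified\<close> mirrors one equation of \<open>eval\<close>, and
  a prefix of \<open>g\<close> answers queries as \<open>g\<close> does.\<close>

lemma justified_sound:
  assumes "justified (g [0 \<rightarrow> m]) C t" and C: "\<And>r. r \<in> set C \<Longrightarrow> holds g r"
  shows "holds g t"
  using assms(1) unfolding justified_def
proof (elim disjE)
  assume "\<exists>r\<in>set C. \<exists>s\<in>set C. idx t = 5 + 4 * prod_encode (idx r, idx s) \<and>
        arg r = arg t \<and> arg s = arg t \<and> val t = prod_encode (val r, val s)"
  then obtain r s where rs: "r \<in> set C" "s \<in> set C" and i: "idx t = 5 + 4 * prod_encode (idx r, idx s)"
    and a: "arg r = arg t" "arg s = arg t" and v: "val t = prod_encode (val r, val s)" by blast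
  show ?thesis unfolding i prog_of_simps v using C[OF rs(1)] C[OF rs(2)] a by simp
next
  assume "\<exists>r\<in>set C. \<exists>s\<in>set C. idx t = 6 + 4 * prod_encode (idx s, idx r) \<and>
        arg r = arg t \<and> arg s = val r \<and> val t = val s"
  then obtain r s where rs: "r \<in> set C" "s \<in> set C" and i: "idx t = 6 + 4 * prod_encode (idx s, idx r)"
    and a: "arg r = arg t" "arg s = val r" and v: "val t = val s" by blast
  show ?thesis unfolding i prog_of_simps v using C[OF rs(1)] C[OF rs(2)] a by simp
next
  assume "\<exists>r\<in>set C. \<exists>q<idx t. idx t = 7 + 4 * prod_encode (idx r, q) \<and>
        arg t = prod_encode (arg r, 0) \<and> val t = val r"
  then obtain r q where r: "r \<in> set C" and i: "idx t = 7 + 4 * prod_encode (idx r, q)"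
    and a: "arg t = prod_encode (arg r, 0)" and v: "val t = val r" by blast
  show ?thesis unfolding i prog_of_simps v a using C[OF r] by simp
next
  assume "\<exists>r\<in>set C. \<exists>s\<in>set C. \<exists>p<idx t. idx t = 7 + 4 * prod_encode (p, idx s) \<and>
        idx r = idx t \<and> arg t = prod_encode (p1 (arg r), Suc (p2 (arg r))) \<and>
        arg s = prod_encode (p1 (arg r), prod_encode (p2 (arg r), val r)) \<and> val t = val s"
  then obtain r s p where rs: "r \<in> set C" "s \<in> set C" and i: "idx t = 7 + 4 * prod_encode (p, idx s)"
    "idx r = idx t" and a: "arg t = prod_encode (p1 (arg r), Suc (p2 (arg r)))"
    "arg s = prod_encode (p1 (arg r), prod_encode (p2 (arg r), val r))" and v: "val t = val s" by blast
  \<comment> \<open>The claim \<open>r\<close> is about the same program one round earlier, so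
    unfolding one round suffices.\<close>
  have "eval g (Prec (prog_of p) (prog_of (idx s))) (arg r) = Some (val r)"
    using C[OF rs(1)] unfolding i prog_of_simps .
  then show ?thesis unfolding i prog_of_simps v a using C[OF rs(2)] a(2)
    by (simp add: case_prod_unfold)
next
  assume "\<exists>r\<in>set C. idx t = 8 + 4 * idx r \<and> arg r = prod_encode (arg t, val t) \<and> val r = 0 \<and>
        (\<forall>j<val t. \<exists>s\<in>set C. idx s = idx r \<and> arg s = prod_encode (arg t, j) \<and> val s \<noteq> 0)"
  then obtain r where r: "r \<in> set C" and i: "idx t = 8 + 4 * idx r"
    and a: "arg r = prod_encode (arg t, val t)" "val r = 0"
    and s: "\<And>j. j < val t \<Longrightarrow> \<exists>s\<in>set C. idx s = idx r \<and> arg s = prod_encode (arg t, j) \<and> val s \<noteq> 0"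
    by blast
  have "minimize (\<lambda>k. eval g (prog_of (idx r)) (prod_encode (arg t, k))) = Some (val t)"
  proof (rule minimize_SomeI)
    show "eval g (prog_of (idx r)) (prod_encode (arg t, val t)) = Some 0"
      using C[OF r] a by simp
    show "\<exists>y. eval g (prog_of (idx r)) (prod_encode (arg t, j)) = Some y \<and> y \<noteq> 0" if "j < val t" for j
      using s[OF that] C by metis
  qed
  then show ?thesis unfolding i prog_of_simps by simp
qed simp_all

lemma certificate_sound:
  "certificate (g [0 \<rightarrow> m]) c \<Longrightarrow> t \<in> set c \<Longrightarrow> holds g t"
proof (induction c arbitrary: t)
  case (Cons r c)
  then show ?case using justified_sound[of g m c r] by (cases "t = r") simp_all
qed simp

section \<open>Completeness of certificates\<close>

definition certified :: "(nat \<Rightarrow> nat) \<Rightarrow> nat \<Rightarrow> bool" where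
  "certified g t \<longleftrightarrow> (\<exists>m c. certificate (g [0 \<rightarrow> m]) c \<and> t \<in> set c)"

lemma prefix_le: "m \<le> n \<Longrightarrow> g [0 \<rightarrow> n] = g [0 \<rightarrow> m] @ (g [m \<rightarrow> n])"
  by (metis subsequence_append le_add_diff_inverse)

text \<open>Certificates over different prefixes remain valid over the longest one and can be
  concatenated there.\<close>

lemma certified_finite:
  assumes "finite F" "\<And>t. t \<in> F \<Longrightarrow> certified g t"
  shows "\<exists>m c. certificate (g [0 \<rightarrow> m]) c \<and> F \<subseteq> set c"
  using assms
proof (induction F)
  case empty
  show ?case by (meson certificate_Nil empty_subsetI)
next
  case (insert t F)
  obtain m c where 1: "certificate (g [0 \<rightarrow> m]) c" "F \<subseteq> set c" using insert by auto
  obtain n d where 2: "certificate (g [0 \<rightarrow> n]) d" "t \<in> set d"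
    using insert.prems[of t] unfolding certified_def by auto
  have "certificate (g [0 \<rightarrow> max m n]) c" "certificate (g [0 \<rightarrow> max m n]) d"
    using certificate_mono[OF 1(1)] certificate_mono[OF 2(1)] prefix_le
    by (metis max.cobounded1, metis max.cobounded2)
  then have "certificate (g [0 \<rightarrow> max m n]) (c @ d)" by (rule certificate_append)
  then show ?case using 1 2 by (intro exI[of _ "max m n"] exI[of _ "c @ d"]) auto
qed

text \<open>One derivation step. The list \<open>C\<close> is arbitrary because a certificate
  covering \<open>F\<close> also contains auxiliary claims.\<close>

lemma certifiedI:
  assumes "finite F" "\<And>r. r \<in> F \<Longrightarrow> certified g r"
    and t: "\<And>C. F \<subseteq> set C \<Longrightarrow> justified (g [0 \<rightarrow> m]) C t"
  shows "certified g t"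
proof -
  obtain n c where c: "certificate (g [0 \<rightarrow> n]) c" "F \<subseteq> set c"
    using certified_finite[OF assms(1,2)] by blast
  have "certificate (g [0 \<rightarrow> max m n]) c"
    using certificate_mono[OF c(1)] prefix_le[of n "max m n" g] by auto
  moreover have "justified (g [0 \<rightarrow> max m n]) c t"
    using justified_mono[OF t[OF c(2)] order.refl] prefix_le[of m "max m n" g] by auto
  ultimately have "certificate (g [0 \<rightarrow> max m n]) (t # c)" by simp
  then show ?thesis unfolding certified_def by (meson list.set_intros(1))
qed

text \<open>The use principle: a halting computation asks finitely many oracle questions, so it
  leaves a finite derivation over a prefix of \<open>g\<close>.\<close>

lemma certified_eval: "eval g p n = Some v \<Longrightarrow> certified g (fact_code (godel p) n v)"
proof (induction p arbitrary: n v)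
  case Zero
  then show ?case by - (rule certifiedI[of "{}"], simp_all add: justified_def)
next
  case Succ
  then show ?case by - (rule certifiedI[of "{}"], simp_all add: justified_def)
next
  case Fst
  then show ?case by - (rule certifiedI[of "{}"], simp_all add: justified_def)
next
  case Snd
  then show ?case by - (rule certifiedI[of "{}"], simp_all add: justified_def)
next
  case Oracle
  \<comment> \<open>Position \<open>n\<close> belongs to the prefix only from length
    \<open>Suc n\<close> on.\<close>
  then show ?case by - (rule certifiedI[of "{}" g "Suc n"], simp_all add: justified_def)
next
  case (Pair p q)
  then obtain x y where "eval g p n = Some x" "eval g q n = Some y" and v: "v = prod_encode (x, y)"
    by (auto simp: bind_eq_Some_conv)
  then have c: "certified g (fact_code (godel p) n x)" "certified g (fact_code (godel q) n y)"
    using Pair.IH by auto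
  show ?case
  proof (rule certifiedI[of "{fact_code (godel p) n x, fact_code (godel q) n y}"])
    fix C assume "{fact_code (godel p) n x, fact_code (godel q) n y} \<subseteq> set C"
    then have "\<exists>r\<in>set C. \<exists>s\<in>set C. godel (Pair p q) = 5 + 4 * prod_encode (idx r, idx s) \<and>
        arg r = n \<and> arg s = n \<and> v = prod_encode (val r, val s)"
      using v by (intro bexI[of _ "fact_code (godel p) n x"] bexI[of _ "fact_code (godel q) n y"]) auto
    then show "justified (g [0 \<rightarrow> 0]) C (fact_code (godel (Pair p q)) n v)"
      unfolding justified_def fact_code_simps by blast
  qed (use c in auto)
next
  case (Comp p q)
  then obtain x where "eval g q n = Some x" "eval g p x = Some v"
    by (auto simp: bind_eq_Some_conv)
  then have c: "certified g (fact_code (godel q) n x)" "certified g (fact_code (godel p) x v)"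
    using Comp.IH by auto
  show ?case
  proof (rule certifiedI[of "{fact_code (godel q) n x, fact_code (godel p) x v}"])
    fix C assume "{fact_code (godel q) n x, fact_code (godel p) x v} \<subseteq> set C"
    then have "\<exists>r\<in>set C. \<exists>s\<in>set C. godel (Comp p q) = 6 + 4 * prod_encode (idx s, idx r) \<and>
        arg r = n \<and> arg s = val r \<and> v = val s"
      by (intro bexI[of _ "fact_code (godel q) n x"] bexI[of _ "fact_code (godel p) x v"]) auto
    then show "justified (g [0 \<rightarrow> 0]) C (fact_code (godel (Comp p q)) n v)"
      unfolding justified_def fact_code_simps by blast
  qed (use c in auto)
next
  case (Prec p q)
  obtain a k where n: "n = prod_encode (a, k)" by (metis prod_decode_inverse surj_pair)
  \<comment> \<open>These inequalities meet the bounds on program indices in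
    \<open>justified\<close>.\<close>
  have lt: "godel p < godel (Prec p q)" "godel q < godel (Prec p q)"
    using le_prod_encode_1[of "godel p" "godel q"] le_prod_encode_2[of "godel q" "godel p"] by simp_all
  \<comment> \<open>The inner induction follows the rounds of the recursion; each round is a claim
    about the same program.\<close>
  show ?case using Prec.prems unfolding n
  proof (induction k arbitrary: v)
    case 0
    then have c: "certified g (fact_code (godel p) a v)" using Prec.IH(1) by simp
    show ?case
    proof (rule certifiedI[of "{fact_code (godel p) a v}"])
      fix C assume "{fact_code (godel p) a v} \<subseteq> set C"
      then have "\<exists>r\<in>set C. \<exists>i<godel (Prec p q). godel (Prec p q) = 7 + 4 * prod_encode (idx r, i) \<and>
          prod_encode (a, 0) = prod_encode (arg r, 0) \<and> v = val r"
        using lt by (intro bexI[of _ "fact_code (godel p) a v"] exI[of _ "godel q"]) auto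
      then show "justified (g [0 \<rightarrow> 0]) C (fact_code (godel (Prec p q)) (prod_encode (a, 0)) v)"
        unfolding justified_def fact_code_simps by blast
    qed (use c in auto)
  next
    case (Suc k)
    define e where "e = godel (Prec p q)"
    obtain z where z: "eval g (Prec p q) (prod_encode (a, k)) = Some z"
      "eval g q (prod_encode (a, prod_encode (k, z))) = Some v"
      using Suc.prems by (auto simp: bind_eq_Some_conv)
    define r s where "r = fact_code e (prod_encode (a, k)) z"
      and "s = fact_code (godel q) (prod_encode (a, prod_encode (k, z))) v"
    have c: "certified g r" "certified g s"
      using Suc.IH[OF z(1)] Prec.IH(2)[OF z(2)] by (simp_all add: r_def s_def e_def)
    show ?case unfolding e_def[symmetric]
    proof (rule certifiedI[of "{r, s}"])
      fix C assume "{r, s} \<subseteq> set C"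
      then have "\<exists>r\<in>set C. \<exists>s\<in>set C. \<exists>i<e. e = 7 + 4 * prod_encode (i, idx s) \<and>
          idx r = e \<and> prod_encode (a, Suc k) = prod_encode (p1 (arg r), Suc (p2 (arg r))) \<and>
          arg s = prod_encode (p1 (arg r), prod_encode (p2 (arg r), val r)) \<and> v = val s"
        using lt by (intro bexI[of _ r] bexI[of _ s] exI[of _ "godel p"]) (auto simp: r_def s_def e_def)
      then show "justified (g [0 \<rightarrow> 0]) C (fact_code e (prod_encode (a, Suc k)) v)"
        unfolding justified_def fact_code_simps by blast
    qed (use c in auto)
  qed
next
  case (Mu p)
  let ?h = "\<lambda>k. eval g p (prod_encode (n, k))"
  have m: "minimize ?h = Some v" using Mu.prems by simp
  obtain y where y: "\<And>j. j < v \<Longrightarrow> ?h j = Some (y j) \<and> y j \<noteq> 0"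
    using minimize_SomeD(2)[OF m] by metis
  define r where "r = fact_code (godel p) (prod_encode (n, v)) 0"
  \<comment> \<open>Each unsuccessful trial contributes a claim with a nonzero value.\<close>
  define s where "s j = fact_code (godel p) (prod_encode (n, j)) (y j)" for j
  have c: "certified g r" "\<And>j. j < v \<Longrightarrow> certified g (s j)"
    unfolding r_def s_def using Mu.IH[OF minimize_SomeD(1)[OF m]] Mu.IH y by blast+
  show ?case
  proof (rule certifiedI[of "insert r (s ` {..<v})"])
    fix C assume C: "insert r (s ` {..<v}) \<subseteq> set C"
    have "\<forall>j<v. \<exists>s\<in>set C. idx s = idx r \<and> arg s = prod_encode (n, j) \<and> val s \<noteq> 0"
    proof (intro allI impI)
      fix j assume "j < v"
      then show "\<exists>s\<in>set C. idx s = idx r \<and> arg s = prod_encode (n, j) \<and> val s \<noteq> 0"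
        using C y by (intro bexI[of _ "s j"]) (auto simp: r_def s_def)
    qed
    then have "\<exists>r\<in>set C. godel (Mu p) = 8 + 4 * idx r \<and> arg r = prod_encode (n, v) \<and> val r = 0 \<and>
        (\<forall>j<v. \<exists>s\<in>set C. idx s = idx r \<and> arg s = prod_encode (n, j) \<and> val s \<noteq> 0)"
      using C by (intro bexI[of _ r]) (auto simp: r_def)
    then show "justified (g [0 \<rightarrow> 0]) C (fact_code (godel (Mu p)) n v)"
      unfolding justified_def fact_code_simps by blast
  qed (use c in auto)
qed

text \<open>The number \<open>z\<close> codes a node of \<open>T\<close> together with a
  certificate. Bounding it by the length of \<open>\<tau>\<close> acts as a bound on the stage and
  keeps the relation decidable.\<close>

definition agree :: "nat list set \<Rightarrow> nat \<Rightarrow> nat \<Rightarrow> nat list \<Rightarrow> bool" where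
  "agree T e n \<tau> \<longleftrightarrow> (\<exists>z<length \<tau>. length (list_decode (p1 z)) = n \<and> list_decode (p1 z) \<in> T \<and>
     certificate \<tau> (list_decode (p2 z)) \<and>
     (\<forall>i<n. \<exists>t\<in>set (list_decode (p2 z)). t = fact_code e i ((list_decode (p1 z) \<frown> (\<lambda>_. 0)) i)))"

lemma agree_sound:
  assumes "agree T e n (g [0 \<rightarrow> m])"
  shows "\<exists>\<eta>\<in>T. length \<eta> = n \<and> (\<forall>i<n. eval g (prog_of e) i = Some (\<eta> ! i))"
proof -
  obtain z where z: "length (list_decode (p1 z)) = n" "list_decode (p1 z) \<in> T"
    "certificate (g [0 \<rightarrow> m]) (list_decode (p2 z))"
    "\<forall>i<n. \<exists>t\<in>set (list_decode (p2 z)). t = fact_code e i ((list_decode (p1 z) \<frown> (\<lambda>_. 0)) i)"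
    using assms unfolding agree_def by (elim exE conjE)
  have "eval g (prog_of e) i = Some (list_decode (p1 z) ! i)" if "i < n" for i
    using certificate_sound[OF z(3)] z(4)[rule_format, OF that] z(1) that by force
  then show ?thesis using z by blast
qed

text \<open>The continuation \<open>\<upsilon>\<close> is arbitrary because the prefix of
  \<open>g\<close> will later be continued to a leaf, possibly away from \<open>g\<close>.\<close>

lemma agree_complete:
  assumes "Phi e g = Some h" "h [0 \<rightarrow> n] \<in> T"
  shows "\<exists>m. \<forall>\<upsilon>. agree T e n (g [0 \<rightarrow> m] @ \<upsilon>)"
proof -
  have "eval g (prog_of e) i = Some (h i)" for i
    using assms(1) unfolding Phi_def by (auto split: if_splits)
  then have "certified g (fact_code e i (h i))" for i
    using certified_eval[of g "prog_of e" i] by simp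
  then obtain m c where c: "certificate (g [0 \<rightarrow> m]) c" "(\<lambda>i. fact_code e i (h i)) ` {..<n} \<subseteq> set c"
    using certified_finite[of "(\<lambda>i. fact_code e i (h i)) ` {..<n}" g] by blast
  define z where "z = prod_encode (list_encode (h [0 \<rightarrow> n]), list_encode c)"
  \<comment> \<open>This length covers the oracle queries of \<open>c\<close> and exceeds
    \<open>z\<close>, as the bound in \<open>agree\<close> demands.\<close>
  have "agree T e n (g [0 \<rightarrow> m + Suc z] @ \<upsilon>)" for \<upsilon>
    unfolding agree_def
  proof (intro exI[of _ z] conjI allI impI)
    show "certificate (g [0 \<rightarrow> m + Suc z] @ \<upsilon>) (list_decode (p2 z))"
      using certificate_mono[OF c(1)] subsequence_append[of g m "Suc z"] by (simp add: z_def)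
    show "\<exists>t\<in>set (list_decode (p2 z)). t = fact_code e i ((list_decode (p1 z) \<frown> (\<lambda>_. 0)) i)"
      if "i < n" for i using c(2) that by (auto simp: z_def)
  qed (use assms(2) in \<open>auto simp: z_def\<close>)
  then show ?thesis by blast
qed

section \<open>Elimination of a computable oracle\<close>

primrec subst_oracle :: "prog \<Rightarrow> prog \<Rightarrow> prog" where
  "subst_oracle q Zero = Zero"
| "subst_oracle q Succ = Succ"
| "subst_oracle q Fst = Fst"
| "subst_oracle q Snd = Snd"
| "subst_oracle q Oracle = q"
| "subst_oracle q (Pair a b) = Pair (subst_oracle q a) (subst_oracle q b)"
| "subst_oracle q (Comp a b) = Comp (subst_oracle q a) (subst_oracle q b)"
| "subst_oracle q (Prec a b) = Prec (subst_oracle q a) (subst_oracle q b)"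
| "subst_oracle q (Mu a) = Mu (subst_oracle q a)"

lemma eval_subst_oracle:
  assumes "\<And>n. eval (\<lambda>_. 0) q n = Some (g n)"
  shows "eval (\<lambda>_. 0) (subst_oracle q p) = eval g p"
  by (induction p) (simp_all add: assms)

text \<open>Oracle queries are answered by a program for \<open>g\<close>. This turns a path
  computed from the limit of a computable chain into a computable path.\<close>

lemma computable_relative:
  assumes "computable g" "\<And>n. eval g p n = Some (h n)"
  shows "computable h"
  using assms eval_subst_oracle unfolding computable_def by metis

subsection \<open>Chains of strings\<close>

lemma chain_limit:
  fixes \<gamma> :: "nat \<Rightarrow> nat list"
  assumes "\<And>j. \<exists>\<rho>. \<rho> \<noteq> [] \<and> \<gamma> (Suc j) = \<gamma> j @ \<rho>"
  obtains g where "\<And>j. \<gamma> j = g [0 \<rightarrow> length (\<gamma> j)]" "\<And>j. j \<le> length (\<gamma> j)"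
    "computable_list \<gamma> \<Longrightarrow> computable g"
proof
  \<comment> \<open>Every link adds an entry, so position \<open>i\<close> is present in
    \<open>\<gamma> (Suc i)\<close> and the padding is never read.\<close>
  define g where "g i = (\<gamma> (Suc i) \<frown> (\<lambda>_. 0)) i" for i
  have len: "j \<le> length (\<gamma> j)" for j
  proof (induction j)
    case (Suc j)
    then show ?case using assms[of j] by (auto simp: Suc_le_eq length_greater_0_conv[symmetric]
      simp del: length_greater_0_conv)
  qed simp
  then show "\<And>j. j \<le> length (\<gamma> j)" .
  have ext: "\<exists>\<rho>. \<gamma> (j + d) = \<gamma> j @ \<rho>" for j d
    using assms by (induction d) (simp, metis add_Suc_right append.assoc)
  have nth: "\<gamma> j ! i = \<gamma> k ! i" if "i < length (\<gamma> j)" "i < length (\<gamma> k)" for i j k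
    using ext[of j "k - j"] ext[of k "j - k"] that
    by (cases "j \<le> k") (auto simp: nth_append)
  show "\<gamma> j = g [0 \<rightarrow> length (\<gamma> j)]" for j
  proof (rule nth_equalityI)
    fix i assume "i < length (\<gamma> j)"
    then show "\<gamma> j ! i = (g [0 \<rightarrow> length (\<gamma> j)]) ! i"
      using len[of "Suc i"] nth[of i j "Suc i"] by (simp add: g_def)
  qed simp
  show "computable g" if "computable_list \<gamma>"
    unfolding g_def
    by (intro computable_intros computable_comp[OF that])
qed

text \<open>The next string is the first hit of a search through codes. Away from the chain this
  search may diverge, which \<open>computable_iterate_Least\<close> tolerates.\<close>

lemma computable_chain:
  fixes \<gamma> :: "nat \<Rightarrow> nat list"
  assumes R: "decidable (\<lambda>y. R (list_decode (p1 y)) (list_decode (p2 y)))"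
    and step: "\<And>j. R (\<gamma> j) (\<gamma> (Suc j))"
    and least: "\<And>j \<tau>. R (\<gamma> j) \<tau> \<Longrightarrow> list_encode (\<gamma> (Suc j)) \<le> list_encode \<tau>"
  shows "computable_list \<gamma>"
proof (rule computable_iterate_Least[where R = "\<lambda>x y. R (list_decode x) (list_decode y)"])
  show "\<exists>y. R (list_decode (list_encode (\<gamma> j))) (list_decode y)" for j
    using step[of j] by (auto intro: exI[of _ "list_encode (\<gamma> (Suc j))"])
  show "list_encode (\<gamma> (Suc j)) =
      (LEAST y. R (list_decode (list_encode (\<gamma> j))) (list_decode y))" for j
    using step least by (intro Least_equality[symmetric]) (auto, metis list_decode_inverse)
qed (rule R)

section \<open>Effectively closed classes given by decidable conditions on prefixes\<close>

lemma decidable_binary [computable_intros]: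
  assumes "computable_list f"
  shows "decidable (\<lambda>x. f x \<in> lists {0, 1})"
proof -
  have "(\<forall>t\<in>set xs. t < 2) \<longleftrightarrow> xs \<in> lists {0, 1}" for xs :: "nat list"
    by (auto simp: less_2_cases_iff in_lists_conv_set)
  moreover have "decidable (\<lambda>x. \<forall>t\<in>set (f x). t < 2)" by (intro computable_intros assms)
  ultimately show ?thesis by simp
qed

lemma cantor_prefix: "g \<in> cantor \<longleftrightarrow> (\<forall>m. g [0 \<rightarrow> m] \<in> lists {0, 1})"
proof
  assume "\<forall>m. g [0 \<rightarrow> m] \<in> lists {0, 1}"
  then have "g i \<in> {0, 1}" for i by (auto dest: spec[of _ "Suc i"])
  then show "g \<in> cantor" unfolding cantor_def by (intro CollectI image_subsetI)
qed (auto simp: cantor_def in_lists_conv_set)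

text \<open>A prefix of a string satisfying \<open>R\<close> may violate \<open>R\<close>, so the
  tree consists of the binary strings all of whose prefixes satisfy it.\<close>

lemma pi01I:
  assumes R: "decidable (\<lambda>x. R (list_decode x))"
  shows "pi01 {g \<in> cantor. \<forall>m. R (g [0 \<rightarrow> m])}"
proof -
  define U where "U = {\<sigma> \<in> lists {0, 1}. \<forall>m<Suc (length \<sigma>). R (take m \<sigma>)}"
  have "decidable (\<lambda>x. list_decode x \<in> U)"
  proof -
    have "decidable (\<lambda>y. R (take (p2 y) (list_decode (p1 y))))"
      using computable_comp[OF R, of "\<lambda>y. list_encode (take (p2 y) (list_decode (p1 y)))"]
      by (simp add: computable_take computable_p1 computable_p2 computable_id)
    then have "decidable (\<lambda>x. list_decode x \<in> lists {0, 1} \<and>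
        (\<forall>m<Suc (length (list_decode x)). R (take m (list_decode x))))"
      by (intro computable_intros)
    then show ?thesis by (simp add: U_def)
  qed
  moreover have "\<sigma> \<in> U" if "\<sigma> @ \<tau> \<in> U" for \<sigma> \<tau>
  proof -
    have "R (take m \<sigma>)" if "m < Suc (length \<sigma>)" for m
      using \<open>\<sigma> @ \<tau> \<in> U\<close> that by (auto simp: U_def dest!: spec[of _ m])
    then show ?thesis using that by (auto simp: U_def)
  qed
  ultimately have "computable_tree U"
    unfolding computable_tree_def computable_on_strings_def
    by (auto simp: U_def of_bool_def)
  moreover have "paths U = {g \<in> cantor. \<forall>m. R (g [0 \<rightarrow> m])}"
  proof -
    have "g [0 \<rightarrow> n] \<in> U \<longleftrightarrow> g [0 \<rightarrow> n] \<in> lists {0, 1} \<and> (\<forall>m\<le>n. R (g [0 \<rightarrow> m]))" for g n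
      by (auto simp: U_def less_Suc_eq_le min_def)
    then show ?thesis unfolding paths_def cantor_prefix by blast
  qed
  ultimately show ?thesis unfolding pi01_def by blast
qed

subsection \<open>Leaves of the tree of a special class\<close>

lemma subsequence_cong: "(\<And>i. i < n \<Longrightarrow> g i = h i) \<Longrightarrow> subsequence g m n = subsequence h m n"
  by (auto simp: subsequence_def)

locale special_tree =
  fixes T :: "nat list set"
  assumes tree: "computable_tree T" and special_paths: "special (paths T)"
begin

lemma tree_prefix: "\<sigma> @ \<tau> \<in> T \<Longrightarrow> \<sigma> \<in> T"
  using tree unfolding computable_tree_def by blast

lemma tree_binary: "\<sigma> \<in> T \<Longrightarrow> \<sigma> \<in> lists {0, 1}"
  using tree unfolding computable_tree_def by blast

lemma decidable_tree [computable_intros]: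
  assumes "computable_list f"
  shows "decidable (\<lambda>x. f x \<in> T)"
proof -
  have "decidable (\<lambda>n. list_decode n \<in> T)"
    using tree unfolding computable_tree_def computable_on_strings_def of_bool_def by blast
  from computable_comp[OF this assms] show ?thesis by simp
qed

text \<open>As \<open>T\<close> is binary and closed under prefixes, two membership tests replace
  the quantifier over all extensions; this makes leaves decidable.\<close>

lemma leaf_iff: "\<rho> \<in> leaves T \<longleftrightarrow> \<rho> \<in> T \<and> \<rho> @ [0] \<notin> T \<and> \<rho> @ [1] \<notin> T"
proof
  assume \<rho>: "\<rho> \<in> T \<and> \<rho> @ [0] \<notin> T \<and> \<rho> @ [1] \<notin> T"
  have "\<tau> = []" if "\<rho> @ \<tau> \<in> T" for \<tau>
  proof (cases \<tau>)
    case (Cons x \<tau>')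
    then have "x \<in> {0, 1}" "\<rho> @ [x] \<in> T"
      using that tree_binary[OF that] tree_prefix[of "\<rho> @ [x]" \<tau>'] by auto
    then show ?thesis using \<rho> by auto
  qed
  then show "\<rho> \<in> leaves T" using \<rho> by (auto simp: leaves_def)
qed (auto simp: leaves_def)

lemma decidable_leaf [computable_intros]:
  assumes "computable_list f"
  shows "decidable (\<lambda>x. f x \<in> leaves T)"
  unfolding leaf_iff by (intro computable_intros assms)

lemma leaf_tree: "\<rho> \<in> leaves T \<Longrightarrow> \<rho> \<in> T"
  by (simp add: leaves_def)

lemma leaf_append: "\<sigma> \<in> leaves T \<Longrightarrow> \<sigma> @ \<tau> \<in> leaves T \<Longrightarrow> \<tau> = []"
  by (auto simp: leaves_def)

lemma path_tree: "f \<in> paths T \<Longrightarrow> f [0 \<rightarrow> n] \<in> T"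
  by (simp add: paths_def)

lemma path_not_leaf: "f \<in> paths T \<Longrightarrow> f [0 \<rightarrow> n] \<notin> leaves T"
  using path_tree[of f "Suc n"] by (auto simp: leaves_def)

lemma ex_path: "\<exists>f. f \<in> paths T"
  using special_paths by (auto simp: special_def)

lemma path_not_computable: "f \<in> paths T \<Longrightarrow> \<not> computable f"
  using special_paths by (auto simp: special_def)

text \<open>The root lies on a path. Hence every leaf read in a parse makes progress.\<close>

lemma Nil_not_leaf: "[] \<notin> leaves T"
  using ex_path path_not_leaf[of _ 0] by auto

lemma tree_limit:
  assumes "\<And>n. \<exists>m\<ge>n. g [0 \<rightarrow> m] \<in> T"
  shows "g \<in> paths T"
proof -
  have "g [0 \<rightarrow> n] \<in> T" for n
    using assms[of n] tree_prefix prefix_le by metis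
  then show ?thesis using tree_binary by (simp add: paths_def cantor_prefix)
qed

text \<open>Without a leaf above \<open>\<sigma>\<close>, a computable path could be built by always extending.\<close>

lemma leaf_above:
  assumes \<sigma>: "\<sigma> \<in> T"
  shows "\<exists>\<tau>. \<sigma> @ \<tau> \<in> leaves T"
proof (rule ccontr)
  assume no: "\<nexists>\<tau>. \<sigma> @ \<tau> \<in> leaves T"
  define R where "R \<alpha> \<beta> \<longleftrightarrow> \<beta> \<in> T \<and> length \<beta> = Suc (length \<alpha>) \<and> take (length \<alpha>) \<beta> = \<alpha>"
    for \<alpha> \<beta> :: "nat list"
  \<comment> \<open>Choosing the least code makes the chain fit
    \<open>computable_chain\<close>.\<close>
  define next_code where "next_code \<alpha> = (LEAST c. R \<alpha> (list_decode c))" for \<alpha>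
  define \<gamma> where "\<gamma> = rec_nat \<sigma> (\<lambda>_ \<alpha>. list_decode (next_code \<alpha>))"
  have ex: "\<exists>\<beta>. R (\<sigma> @ \<tau>) \<beta>" if "\<sigma> @ \<tau> \<in> T" for \<tau>
  proof -
    have "\<sigma> @ \<tau> \<notin> leaves T" using no by blast
    then have "(\<sigma> @ \<tau>) @ [0] \<in> T \<or> (\<sigma> @ \<tau>) @ [1] \<in> T"
      using that leaf_iff[of "\<sigma> @ \<tau>"] by metis
    then obtain x where "(\<sigma> @ \<tau>) @ [x] \<in> T" by blast
    then have "R (\<sigma> @ \<tau>) ((\<sigma> @ \<tau>) @ [x])" unfolding R_def by simp
    then show ?thesis by blast
  qed
  \<comment> \<open>Staying above \<open>\<sigma>\<close> inside \<open>T\<close> guarantees, by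
    \<open>ex\<close>, that the next search succeeds.\<close>
  have inv: "(\<exists>\<tau>. \<gamma> j = \<sigma> @ \<tau>) \<and> \<gamma> j \<in> T \<and> R (\<gamma> j) (\<gamma> (Suc j))" for j
  proof -
    have R: "R (\<gamma> j) (\<gamma> (Suc j))" if j: "\<exists>\<tau>. \<gamma> j = \<sigma> @ \<tau>" "\<gamma> j \<in> T" for j
    proof -
      obtain \<tau> where \<tau>: "\<gamma> j = \<sigma> @ \<tau>" using j(1) by blast
      obtain \<beta> where "R (\<gamma> j) \<beta>" using ex[of \<tau>] j(2) unfolding \<tau> by blast
      then have "R (\<gamma> j) (list_decode (list_encode \<beta>))" by simp
      then have "R (\<gamma> j) (list_decode (next_code (\<gamma> j)))" unfolding next_code_def by (rule LeastI)
      then show ?thesis by (simp add: \<gamma>_def)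
    qed
    show ?thesis
    proof (induction j)
      case 0
      then show ?case using R[of 0] \<sigma> by (simp add: \<gamma>_def)
    next
      case (Suc j)
      then have "\<gamma> (Suc j) \<in> T" "take (length (\<gamma> j)) (\<gamma> (Suc j)) = \<gamma> j" by (auto simp: R_def)
      moreover from this have "\<gamma> (Suc j) = \<gamma> j @ drop (length (\<gamma> j)) (\<gamma> (Suc j))"
        by (metis append_take_drop_id)
      ultimately show ?case using Suc R[of "Suc j"] by (metis append.assoc)
    qed
  qed
  have "\<exists>\<rho>. \<rho> \<noteq> [] \<and> \<gamma> (Suc j) = \<gamma> j @ \<rho>" for j
  proof -
    have R: "R (\<gamma> j) (\<gamma> (Suc j))" using inv by blast
    then have "\<gamma> (Suc j) = \<gamma> j @ drop (length (\<gamma> j)) (\<gamma> (Suc j))"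
      unfolding R_def by (metis append_take_drop_id)
    moreover have "drop (length (\<gamma> j)) (\<gamma> (Suc j)) \<noteq> []" using R by (simp add: R_def)
    ultimately show ?thesis by blast
  qed
  then obtain g where g: "\<And>j. \<gamma> j = g [0 \<rightarrow> length (\<gamma> j)]" "\<And>j. j \<le> length (\<gamma> j)"
    "computable_list \<gamma> \<Longrightarrow> computable g" by (rule chain_limit) blast
  have "computable_list \<gamma>"
  proof (rule computable_chain[of R])
    show "decidable (\<lambda>y. R (list_decode (p1 y)) (list_decode (p2 y)))"
      unfolding R_def by (intro computable_intros)
    show "R (\<gamma> j) (\<gamma> (Suc j))" for j using inv by blast
    show "list_encode (\<gamma> (Suc j)) \<le> list_encode \<tau>" if "R (\<gamma> j) \<tau>" for j \<tau>
      using that by (auto simp: \<gamma>_def next_code_def intro!: Least_le)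
  qed
  moreover have "g \<in> paths T"
    using g(1,2) inv by (intro tree_limit) metis
  ultimately show False using g(3) path_not_computable by blast
qed


subsection \<open>Parsing into leaves\<close>

text \<open>No leaf is a proper prefix of another one, so a greedy parse of \<open>g\<close> into leaves is the only
  one; \<open>cut g n\<close> is the last position up to \<open>n\<close> where a leaf of this parse ends.\<close>

primrec cut :: "(nat \<Rightarrow> nat) \<Rightarrow> nat \<Rightarrow> nat" where
  "cut g 0 = 0"
| "cut g (Suc n) = (if subsequence g (cut g n) (Suc n) \<in> leaves T then Suc n else cut g n)"

lemma cut_le: "cut g n \<le> n"
  by (induction n) auto

lemma cut_mono: "m \<le> n \<Longrightarrow> cut g m \<le> cut g n"
proof (induction n rule: dec_induct)
  case (step n)
  then show ?case using cut_le[of g n] by auto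
qed simp

lemma cut_cong: "(\<And>i. i < n \<Longrightarrow> g i = h i) \<Longrightarrow> cut g n = cut h n"
proof (induction n)
  case (Suc n)
  then have "cut g n = cut h n" by simp
  moreover have "subsequence g m (Suc n) = subsequence h m (Suc n)" for m
    using Suc.prems by (rule subsequence_cong)
  ultimately show ?case by (simp only: cut.simps)
qed simp

lemma cut_idem: "cut g (cut g n) = cut g n"
  by (induction n) (auto simp del: cut.simps(2), auto)

lemma cut_conc_cong: "n \<le> length \<beta> \<Longrightarrow> cut (\<beta> \<frown> g) n = cut (\<beta> \<frown> h) n"
  by (rule cut_cong) simp

lemma cut_prefix: "n \<le> m \<Longrightarrow> cut (g [0 \<rightarrow> m] \<frown> h) n = cut g n"
  by (rule cut_cong) simp

text \<open>The parse remembers nothing but its last cut, so at \<open>r\<close> it starts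
  afresh.\<close>

lemma cut_suffix: "cut g r = r \<Longrightarrow> cut g (r + n) = r + cut (suffix r g) n"
proof (induction n)
  case (Suc n)
  have c: "cut g (r + n) = r + cut (suffix r g) n" using Suc by blast
  have "subsequence g (cut g (r + n)) (Suc (r + n)) = subsequence (suffix r g) (cut (suffix r g) n) (Suc n)"
    unfolding subsequence_shift c by (simp only: add_Suc_right)
  then show ?case
    by (cases "subsequence (suffix r g) (cut (suffix r g) n) (Suc n) \<in> leaves T")
      (simp_all only: cut.simps add_Suc_right c if_True if_False)
qed simp

lemma computable_cut [computable_intros]:
  assumes "computable_list f" "computable k"
  shows "computable (\<lambda>x. cut (f x \<frown> (\<lambda>_. 0)) (k x))"
proof -
  have "computable (\<lambda>x. rec_nat 0 (\<lambda>n r. if subsequence (f x \<frown> (\<lambda>_. 0)) r (Suc n) \<in> leaves T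
      then Suc n else r) (k x))"
    by (intro computable_intros assms computable_comp[OF assms(1)])
  moreover have "rec_nat 0 (\<lambda>n r. if subsequence g r (Suc n) \<in> leaves T then Suc n else r) n = cut g n"
    for g n by (induction n) (simp_all del: subseq_to_Suc)
  ultimately show ?thesis by (simp only:)
qed

text \<open>No proper prefix of a leaf is a leaf, so nothing can be cut off earlier.\<close>

lemma cut_leaf:
  assumes "\<rho> \<in> leaves T"
  shows "n < length \<rho> \<Longrightarrow> cut (\<rho> \<frown> g) n = 0" "cut (\<rho> \<frown> g) (length \<rho>) = length \<rho>"
proof -
  show 1: "cut (\<rho> \<frown> g) n = 0" if "n < length \<rho>" for n
    using that
  proof (induction n)
    case (Suc n)
    have "take (Suc n) \<rho> \<notin> leaves T"
      using leaf_append[of "take (Suc n) \<rho>" "drop (Suc n) \<rho>"] assms Suc.prems by auto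
    moreover have "subsequence (\<rho> \<frown> g) 0 (Suc n) = take (Suc n) \<rho>"
      using Suc.prems by (intro prefix_conc_fst) simp
    ultimately show ?case using Suc by (simp only: cut.simps) simp
  qed simp
  obtain n where n: "length \<rho> = Suc n"
    using assms Nil_not_leaf by (cases \<rho>) auto
  have "subsequence (\<rho> \<frown> g) 0 (Suc n) = \<rho>"
    using prefix_conc_length[of \<rho> g] n by (simp only:)
  then show "cut (\<rho> \<frown> g) (length \<rho>) = length \<rho>"
    unfolding n cut.simps using 1[of n] n assms by (simp only: lessI if_True)
qed

lemma cut_path: "f \<in> paths T \<Longrightarrow> cut f n = 0"
  by (induction n) (simp_all only: cut.simps path_not_leaf if_False)

lemma cut_append_leaf:
  assumes "cut (\<beta> \<frown> g) (length \<beta>) = length \<beta>" "\<rho> \<in> leaves T"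
  shows "n < length \<rho> \<Longrightarrow> cut ((\<beta> @ \<rho>) \<frown> g) (length \<beta> + n) = length \<beta>"
    "cut ((\<beta> @ \<rho>) \<frown> g) (length (\<beta> @ \<rho>)) = length (\<beta> @ \<rho>)"
proof -
  \<comment> \<open>The cut at the end of \<open>\<beta>\<close> depends on \<open>\<beta>\<close>
    alone, so it survives inserting \<open>\<rho>\<close> before \<open>g\<close>.\<close>
  have c: "cut (\<beta> \<frown> \<rho> \<frown> g) (length \<beta>) = length \<beta>"
    using assms(1) cut_conc_cong[OF order.refl, of \<beta> g "\<rho> \<frown> g"] by (simp only:)
  have s: "suffix (length \<beta>) (\<beta> \<frown> \<rho> \<frown> g) = \<rho> \<frown> g" by (rule suffix_conc_length)
  show "n < length \<rho> \<Longrightarrow> cut ((\<beta> @ \<rho>) \<frown> g) (length \<beta> + n) = length \<beta>"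
    using cut_suffix[OF c, of n] cut_leaf(1)[OF assms(2), of n g] unfolding s conc_conc by simp
  show "cut ((\<beta> @ \<rho>) \<frown> g) (length (\<beta> @ \<rho>)) = length (\<beta> @ \<rho>)"
    using cut_suffix[OF c, of "length \<rho>"] cut_leaf(2)[OF assms(2), of g] unfolding s conc_conc by simp
qed

lemma cut_concat:
  assumes "set \<rho>s \<subseteq> leaves T"
  shows "cut (concat \<rho>s \<frown> g) (length (concat \<rho>s)) = length (concat \<rho>s)"
  using assms
proof (induction \<rho>s arbitrary: g rule: rev_induct)
  case (snoc \<rho> \<rho>s)
  then show ?case using cut_append_leaf(2)[of "concat \<rho>s" g \<rho>] by simp
qed simp

text \<open>This makes the learner converge: after the last leaf a path follows, and no prefix of a
  path is a leaf.\<close>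

lemma nabla_cut:
  assumes "g \<in> nabla T"
  obtains r where "suffix r g \<in> paths T" "\<And>n. r \<le> n \<Longrightarrow> cut g n = r"
proof -
  obtain \<rho>s f where \<rho>s: "set \<rho>s \<subseteq> leaves T" "f \<in> paths T" and g: "g = concat \<rho>s \<frown> f"
    using assms unfolding nabla_eq by blast
  let ?r = "length (concat \<rho>s)"
  have s: "suffix ?r g = f" unfolding g by (rule suffix_conc_length)
  have "cut g n = ?r" if "?r \<le> n" for n
    using cut_suffix[of g ?r "n - ?r"] cut_concat[OF \<rho>s(1), of f] cut_path[OF \<rho>s(2)] that s
    by (simp add: g)
  then show ?thesis using that[of ?r] s \<rho>s(2) by simp
qed

text \<open>Each move of the cut closes one more leaf. This supplies the leaves that place an
  element of \<open>diagonal\<close> in \<open>nabla T\<close>.\<close>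

lemma concat_cut: "\<exists>\<rho>s. set \<rho>s \<subseteq> leaves T \<and> concat \<rho>s = g [0 \<rightarrow> cut g n]"
proof (induction n)
  case 0
  show ?case by (rule exI[of _ "[]"]) simp
next
  case (Suc n)
  then obtain \<rho>s where \<rho>s: "set \<rho>s \<subseteq> leaves T" "concat \<rho>s = g [0 \<rightarrow> cut g n]" by blast
  show ?case
  proof (cases "subsequence g (cut g n) (Suc n) \<in> leaves T")
    case True
    then have "concat (\<rho>s @ [subsequence g (cut g n) (Suc n)]) = g [0 \<rightarrow> cut g (Suc n)]"
      using \<rho>s(2) prefix_le[of "cut g n" "Suc n" g] cut_le[of g n] by (simp only: cut.simps) simp
    then show ?thesis using \<rho>s(1) True by (intro exI[of _ "\<rho>s @ [subsequence g (cut g n) (Suc n)]"]) simp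
  next
    case False
    then show ?thesis using \<rho>s by (simp only: cut.simps if_False) blast
  qed
qed


subsection \<open>A diagonal class inside the iterated concatenation\<close>

text \<open>A base \<open>\<beta>\<close> is extended by a leaf only if some \<open>\<Phi>\<^sub>e\<close> with \<open>e\<close> below the first cut (that is,
  \<open>cut e = 0\<close>) thereby computes a node of \<open>T\<close> as long as \<open>\<beta>\<close>; taking the least such leaf makes
  chains of extensions computable.\<close>

definition extends :: "nat list \<Rightarrow> nat list \<Rightarrow> bool" where
  "extends \<beta> \<tau> \<longleftrightarrow> take (length \<beta>) \<tau> = \<beta> \<and> drop (length \<beta>) \<tau> \<in> leaves T \<and>
     (\<exists>e<length \<beta>. cut (\<beta> \<frown> (\<lambda>_. 0)) e = 0 \<and> agree T e (length \<beta>) \<tau>)"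

definition step :: "nat list \<Rightarrow> nat list \<Rightarrow> bool" where
  "step \<beta> \<tau> \<longleftrightarrow> extends \<beta> \<tau> \<and> (\<forall>c<list_encode \<tau>. \<not> extends \<beta> (list_decode c))"

text \<open>The guard \<open>0 < cut g (n - 1)\<close> leaves the first leaf unconstrained, so that
  arbitrarily many indices can be taken into account after it. Only the first \<open>n\<close>
  entries of \<open>g\<close> matter.\<close>

definition consistent :: "(nat \<Rightarrow> nat) \<Rightarrow> nat \<Rightarrow> bool" where
  "consistent g n \<longleftrightarrow> subsequence g (cut g n) n \<in> T \<and>
     (0 < cut g (n - 1) \<and> cut g n = n \<longrightarrow> step (g [0 \<rightarrow> cut g (n - 1)]) (g [0 \<rightarrow> n]))"

definition diagonal :: "(nat \<Rightarrow> nat) set" where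
  "diagonal = {g \<in> cantor. \<forall>n. consistent g n}"

section \<open>The diagonal class is effectively closed\<close>

lemma decidable_agree [computable_intros]:
  assumes "computable e" "computable n" "computable_list f"
  shows "decidable (\<lambda>x. agree T (e x) (n x) (f x))"
  unfolding agree_def fact_code_def
  by (intro computable_intros assms assms[THEN computable_comp])

lemma decidable_extends [computable_intros]:
  assumes "computable_list f" "computable_list g"
  shows "decidable (\<lambda>x. extends (f x) (g x))"
  unfolding extends_def
  by (intro computable_intros assms assms[THEN computable_comp])

lemma decidable_step [computable_intros]:
  assumes "computable_list f" "computable_list g"
  shows "decidable (\<lambda>x. step (f x) (g x))"
  unfolding step_def
  by (intro computable_intros assms assms[THEN computable_comp])

lemma extends_append: "extends \<beta> \<tau> \<Longrightarrow> \<exists>\<rho>\<in>leaves T. \<tau> = \<beta> @ \<rho>"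
  unfolding extends_def by (metis append_take_drop_id)

lemma step_append: "step \<beta> \<tau> \<Longrightarrow> \<exists>\<rho>\<in>leaves T. \<tau> = \<beta> @ \<rho>"
  unfolding step_def using extends_append by blast

lemma step_least: "step \<beta> \<tau> \<Longrightarrow> extends \<beta> \<tau>' \<Longrightarrow> list_encode \<tau> \<le> list_encode \<tau>'"
  unfolding step_def by (metis list_encode_inverse not_le)

lemma ex_step:
  assumes "extends \<beta> \<tau>"
  shows "\<exists>\<tau>. step \<beta> \<tau>"
proof -
  let ?P = "\<lambda>c. extends \<beta> (list_decode c)"
  have "?P (list_encode \<tau>)" using assms by simp
  then have "?P (Least ?P)" "\<forall>c<Least ?P. \<not> ?P c" by (rule LeastI, blast dest: not_less_Least)
  then have "step \<beta> (list_decode (Least ?P))" by (simp add: step_def)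
  then show ?thesis by blast
qed

lemma consistent_cong:
  assumes "\<And>i. i < n \<Longrightarrow> g i = h i"
  shows "consistent g n \<longleftrightarrow> consistent h n"
proof -
  have c: "cut g n = cut h n" "cut g (n - 1) = cut h (n - 1)"
    using assms by (auto intro: cut_cong)
  have s: "subsequence g m k = subsequence h m k" if "k \<le> n" for m k
    using assms that by (auto intro: subsequence_cong)
  have "cut h (n - 1) \<le> n" using cut_le[of h "n - 1"] by simp
  then show ?thesis unfolding consistent_def c by (simp only: s order.refl)
qed

lemma pi01_diagonal: "pi01 diagonal"
proof -
  have "decidable (\<lambda>x. consistent (list_decode x \<frown> (\<lambda>_. 0)) (length (list_decode x)))"
    unfolding consistent_def by (intro computable_intros)
  then have "pi01 {g \<in> cantor. \<forall>n. consistent (g [0 \<rightarrow> n] \<frown> (\<lambda>_. 0)) (length (g [0 \<rightarrow> n]))}"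
    by (rule pi01I)
  moreover have "consistent (g [0 \<rightarrow> n] \<frown> (\<lambda>_. 0)) (length (g [0 \<rightarrow> n])) \<longleftrightarrow> consistent g n" for g n
    unfolding subsequence_length by (simp, rule consistent_cong) simp
  ultimately show ?thesis by (simp only: diagonal_def)
qed

text \<open>The limit of an infinite chain would be computable, and one of the finitely many \<open>\<Phi>\<^sub>e\<close>
  considered would map it to a path of \<open>T\<close>.\<close>

lemma no_infinite_chain:
  assumes steps: "\<And>j. step (\<gamma> j) (\<gamma> (Suc j))"
    and base: "0 < cut (\<gamma> 0 \<frown> (\<lambda>_. 0)) (length (\<gamma> 0))"
  shows False
proof -
  have "\<exists>\<rho>. \<rho> \<noteq> [] \<and> \<gamma> (Suc j) = \<gamma> j @ \<rho>" for j
    using step_append[OF steps[of j]] Nil_not_leaf by metis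
  then obtain g where g: "\<And>j. \<gamma> j = g [0 \<rightarrow> length (\<gamma> j)]" "\<And>j. j \<le> length (\<gamma> j)"
    "computable_list \<gamma> \<Longrightarrow> computable g" by (rule chain_limit) blast
  have "computable_list \<gamma>"
  proof (rule computable_chain[of extends])
    show "decidable (\<lambda>y. extends (list_decode (p1 y)) (list_decode (p2 y)))"
      by (intro computable_intros)
    show "extends (\<gamma> j) (\<gamma> (Suc j))" for j using steps[of j] by (simp add: step_def)
    show "list_encode (\<gamma> (Suc j)) \<le> list_encode \<tau>" if "extends (\<gamma> j) \<tau>" for j \<tau>
      using step_least[OF steps that] .
  qed
  then have comp: "computable g" by (rule g(3))
  have cut_g: "cut (\<gamma> j \<frown> (\<lambda>_. 0)) n = cut g n" if "n \<le> length (\<gamma> j)" for j n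
    using cut_prefix[OF that, of g "\<lambda>_. 0"] g(1)[of j] by simp
  \<comment> \<open>A positive cut occurs within \<open>\<gamma> 0\<close>, whereas
    \<open>extends\<close> admits only indices before the first cut; this bounds the index uniformly
    in \<open>j\<close>.\<close>
  have "\<exists>e<length (\<gamma> 0). agree T e (length (\<gamma> j)) (\<gamma> (Suc j))" for j
  proof -
    obtain e where e: "e < length (\<gamma> j)" "cut (\<gamma> j \<frown> (\<lambda>_. 0)) e = 0"
      "agree T e (length (\<gamma> j)) (\<gamma> (Suc j))"
      using steps[of j] unfolding step_def extends_def by blast
    have "\<not> length (\<gamma> 0) \<le> e"
      using cut_mono[of "length (\<gamma> 0)" e g] cut_g[of "length (\<gamma> 0)" 0] cut_g[of e j] base e by auto
    then show ?thesis using e(3) by (meson not_le)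
  qed
  then obtain E where E: "\<And>j. E j < length (\<gamma> 0)" "\<And>j. agree T (E j) (length (\<gamma> j)) (\<gamma> (Suc j))"
    by metis
  \<comment> \<open>Finitely many indices serve all stages, so one recurs and yields nodes of
    \<open>T\<close> of unbounded length.\<close>
  have "finite (range E)"
    using E(1) by (intro finite_subset[of "range E" "{..<length (\<gamma> 0)}"]) auto
  then obtain j0 where "infinite {j \<in> UNIV. E j = E j0}"
    using pigeonhole_infinite[of UNIV E] by auto
  then have inf: "\<exists>j\<ge>n. E j = E j0" for n
    unfolding infinite_nat_iff_unbounded_le by blast
  define p where "p = prog_of (E j0)"
  define h where "h i = the (eval g p i)" for i
  have *: "\<exists>m\<ge>n. h [0 \<rightarrow> m] \<in> T \<and> (\<forall>i<m. eval g p i = Some (h i))" for n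
  proof -
    obtain j where j: "j \<ge> n" "E j = E j0" using inf by blast
    have "agree T (E j0) (length (\<gamma> j)) (g [0 \<rightarrow> length (\<gamma> (Suc j))])"
      using E(2)[of j] g(1)[of "Suc j"] j(2) by simp
    from agree_sound[OF this] obtain \<eta> where \<eta>: "\<eta> \<in> T" "length \<eta> = length (\<gamma> j)"
      "\<And>i. i < length (\<gamma> j) \<Longrightarrow> eval g p i = Some (\<eta> ! i)" unfolding p_def by blast
    have "h [0 \<rightarrow> length (\<gamma> j)] = \<eta>"
      using \<eta>(2,3) by (intro nth_equalityI) (simp_all add: h_def)
    then show ?thesis using \<eta> g(2)[of j] j(1)
      by (intro exI[of _ "length (\<gamma> j)"]) (simp add: h_def)
  qed
  have "h \<in> paths T" using * by (intro tree_limit) blast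
  moreover have "eval g p i = Some (h i)" for i using *[of "Suc i"] by auto
  then have "computable h" by (rule computable_relative[OF comp])
  ultimately show False using path_not_computable by blast
qed

text \<open>If the cut kept moving, the prefixes ending at cuts would form an infinite chain of
  steps. Once it rests at \<open>r\<close>, consistency keeps everything after \<open>r\<close> in
  \<open>T\<close>.\<close>

lemma diagonal_subset_nabla: "diagonal \<subseteq> nabla T"
proof
  fix g assume g: "g \<in> diagonal"
  have cons: "consistent g n" for n using g by (simp add: diagonal_def)
  have "\<exists>n0. \<forall>n\<ge>n0. cut g n = cut g n0"
  proof (rule ccontr)
    assume "\<nexists>n0. \<forall>n\<ge>n0. cut g n = cut g n0"
    then have unb: "\<exists>n\<ge>k. cut g k < cut g n" for k using cut_mono[of k _ g] by (metis le_neq_implies_less)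
    let ?P = "\<lambda>_ k. 0 < k \<and> cut g k = k"
    let ?Q = "\<lambda>_ k l. step (g [0 \<rightarrow> k]) (g [0 \<rightarrow> l])"
    have "\<exists>f. \<forall>n. ?P n (f n) \<and> ?Q n (f n) (f (Suc n))"
    proof (rule dependent_nat_choice)
      show "\<exists>k. 0 < k \<and> cut g k = k"
        using unb[of 0] cut_idem by (metis cut.simps(1))
    next
      fix k :: nat and n :: nat assume k: "0 < k \<and> cut g k = k"
      \<comment> \<open>The first position with a larger cut is where the next leaf after
        \<open>k\<close> ends, so consistency at \<open>l\<close> is exactly the step from
        \<open>k\<close> to \<open>l\<close>.\<close>
      define l where "l = (LEAST n. k < cut g n)"
      have "\<exists>n. k < cut g n" using unb[of k] k by auto
      then have l: "k < cut g l" unfolding l_def by (rule LeastI_ex)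
      have "k < l" using l cut_le[of g l] by simp
      then obtain m where m: "l = Suc m" "k \<le> m" by (cases l) auto
      have "\<not> k < cut g m" using not_less_Least[of m "\<lambda>n. k < cut g n"] m(1) l_def by simp
      then have "cut g m = k" using cut_mono[OF m(2), of g] k by simp
      moreover from this have "cut g l = l" using l unfolding m(1) by (auto split: if_splits)
      ultimately have "step (g [0 \<rightarrow> k]) (g [0 \<rightarrow> l])"
        using cons[of l] k m(1) unfolding consistent_def by simp
      then show "\<exists>l. (0 < l \<and> cut g l = l) \<and> step (g [0 \<rightarrow> k]) (g [0 \<rightarrow> l])"
        using \<open>k < l\<close> \<open>cut g l = l\<close> by (intro exI[of _ l]) simp
    qed
    then obtain k where k: "\<And>n. 0 < k n" "\<And>n. cut g (k n) = k n"
      "\<And>n. step (g [0 \<rightarrow> k n]) (g [0 \<rightarrow> k (Suc n)])" by metis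
    show False
      using no_infinite_chain[of "\<lambda>n. subsequence g 0 (k n)"] k(3) cut_prefix[of "k 0" "k 0" g] k(1,2)[of 0]
      by simp
  qed
  then obtain n0 r where r: "\<And>n. n0 \<le> n \<Longrightarrow> cut g n = r" by metis
  have "suffix r g \<in> paths T"
  proof (rule tree_limit)
    fix n
    \<comment> \<open>Taking the maximum goes beyond \<open>n0\<close>, where the cut has settled,
      and still reaches length \<open>n\<close>.\<close>
    have "subsequence g r (r + max n n0) \<in> T"
      using cons[of "r + max n n0"] r[of "r + max n n0"] unfolding consistent_def by simp
    then show "\<exists>m\<ge>n. subsequence (suffix r g) 0 m \<in> T"
      by (intro exI[of _ "max n n0"]) (simp only: subsequence_shift add_0_right max.cobounded1)
  qed
  moreover obtain \<rho>s where "set \<rho>s \<subseteq> leaves T" "concat \<rho>s = g [0 \<rightarrow> r]"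
    using concat_cut[of g n0] r[of n0] by auto
  ultimately have "g [0 \<rightarrow> r] \<frown> suffix r g \<in> nabla T"
    unfolding nabla_eq by (metis (mono_tags, lifting) mem_Collect_eq)
  then show "g \<in> nabla T" by (simp only: prefix_suffix[symmetric])
qed

section \<open>Elements of the diagonal class\<close>

lemma paths_subset_diagonal: "paths T \<subseteq> diagonal"
proof
  fix f assume f: "f \<in> paths T"
  then have "consistent f n" for n
    unfolding consistent_def cut_path[OF f] using path_tree[OF f] by blast
  then show "f \<in> diagonal" using f unfolding diagonal_def paths_def by blast
qed

text \<open>These are the bases from which a path or a further step may be taken. Being nonempty,
  they end in a positive cut, as \<open>no_infinite_chain\<close> requires.\<close>

definition good :: "nat list \<Rightarrow> bool" where
  "good \<beta> \<longleftrightarrow> \<beta> \<in> lists {0, 1} \<and> \<beta> \<noteq> [] \<and> cut (\<beta> \<frown> (\<lambda>_. 0)) (length \<beta>) = length \<beta> \<and>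
     (\<forall>n\<le>length \<beta>. consistent (\<beta> \<frown> (\<lambda>_. 0)) n)"

lemma Nil_tree: "[] \<in> T"
  using ex_path path_tree[of _ 0] by auto

text \<open>Before the end of the leaf the cut is 0, so the clause on \<open>step\<close> is never
  triggered.\<close>

lemma good_leaf:
  assumes \<rho>: "\<rho> \<in> leaves T"
  shows "good \<rho>"
proof -
  let ?w = "\<rho> \<frown> (\<lambda>_. 0)"
  have "consistent ?w n" if n: "n \<le> length \<rho>" for n
  proof -
    have "n - 1 < length \<rho>" using n \<rho> Nil_not_leaf by (cases \<rho>) auto
    then have "cut ?w (n - 1) = 0" by (rule cut_leaf(1)[OF \<rho>])
    moreover have "subsequence ?w (cut ?w n) n \<in> T"
    proof (cases "n = length \<rho>")
      case True
      then show ?thesis using cut_leaf(2)[OF \<rho>] Nil_tree by simp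
    next
      case False
      then have "subsequence ?w (cut ?w n) n = take n \<rho>" using n cut_leaf(1)[OF \<rho>] by simp
      then show ?thesis using tree_prefix[of "take n \<rho>" "drop n \<rho>"] leaf_tree[OF \<rho>] by simp
    qed
    ultimately show ?thesis unfolding consistent_def by simp
  qed
  moreover have "\<rho> \<noteq> []" using \<rho> Nil_not_leaf by blast
  ultimately show ?thesis
    using tree_binary[OF leaf_tree[OF \<rho>]] cut_leaf(2)[OF \<rho>] by (simp add: good_def)
qed

lemma good_consistent:
  assumes "good \<beta>" "n \<le> length \<beta>"
  shows "consistent (\<beta> \<frown> g) n"
proof -
  have "consistent (\<beta> \<frown> (\<lambda>_. 0)) n \<longleftrightarrow> consistent (\<beta> \<frown> g) n"
    using assms(2) by (intro consistent_cong) simp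
  then show ?thesis using assms by (simp add: good_def)
qed

text \<open>Within the new leaf the cut stays at the end of \<open>\<beta>\<close> and the part read
  is a node. At its end the remainder is the empty string, and the demanded step is the given
  one.\<close>

lemma good_step:
  assumes \<beta>: "good \<beta>" and step: "step \<beta> \<tau>"
  shows "good \<tau>"
proof -
  obtain \<rho> where \<rho>: "\<rho> \<in> leaves T" and \<tau>: "\<tau> = \<beta> @ \<rho>" using step_append[OF step] by blast
  let ?w = "\<tau> \<frown> (\<lambda>_. 0)"
  have cut\<beta>: "cut (\<beta> \<frown> (\<lambda>_. 0)) (length \<beta>) = length \<beta>" using \<beta> by (simp add: good_def)
  note cut = cut_append_leaf[OF cut\<beta> \<rho>, folded \<tau>]
  have "consistent ?w n" if n: "n \<le> length \<tau>" for n
  proof (cases "n \<le> length \<beta>")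
    case True
    have "?w = \<beta> \<frown> \<rho> \<frown> (\<lambda>_. 0)" by (simp add: \<tau>)
    then show ?thesis using good_consistent[OF \<beta> True] by (simp only:)
  next
    case False
    then obtain i where i: "n = length \<beta> + Suc i" "i < length \<rho>"
      using n by (auto simp: \<tau> not_le dest!: less_imp_Suc_add)
    have 1: "cut ?w (n - 1) = length \<beta>" using cut(1)[OF i(2)] i(1) by simp
    show ?thesis
    proof (cases "Suc i = length \<rho>")
      case True
      then have n_eq: "n = length \<tau>" by (simp add: i(1) \<tau>)
      then have "cut ?w n = n" using cut(2) by simp
      moreover have "?w [0 \<rightarrow> n] = \<tau>" using n_eq by simp
      moreover have "?w [0 \<rightarrow> length \<beta>] = \<beta>" by (simp add: \<tau>)
      ultimately show ?thesis unfolding consistent_def 1 using Nil_tree step by simp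
    next
      case False
      then have 2: "cut ?w n = length \<beta>" using cut(1)[of "Suc i"] i by simp
      have "subsequence ?w (length \<beta>) n = drop (length \<beta>) (?w [0 \<rightarrow> n])" by simp
      also have "\<dots> = take (Suc i) \<rho>" using i by (simp add: \<tau> take_Suc_conv_app_nth)
      finally have "subsequence ?w (length \<beta>) n \<in> T"
        using tree_prefix[of "take (Suc i) \<rho>" "drop (Suc i) \<rho>"] leaf_tree[OF \<rho>] by simp
      then show ?thesis unfolding consistent_def 1 2 using i(1) by simp
    qed
  qed
  moreover have "\<tau> \<in> lists {0, 1}" "\<tau> \<noteq> []"
    using \<beta> tree_binary[OF leaf_tree[OF \<rho>]] by (auto simp: \<tau> good_def)
  ultimately show ?thesis using cut(2) by (simp add: good_def)
qed

text \<open>No leaf is a prefix of a path, so no further cut, and hence no further demand, arises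
  after \<open>\<beta>\<close>.\<close>

lemma good_path:
  assumes \<beta>: "good \<beta>" and f: "f \<in> paths T"
  shows "\<beta> \<frown> f \<in> diagonal"
proof -
  let ?w = "\<beta> \<frown> f"
  have cut: "cut ?w (length \<beta>) = length \<beta>"
    using \<beta> cut_conc_cong[OF order.refl, of \<beta> "\<lambda>_. 0" f] by (simp add: good_def)
  have "consistent ?w n" for n
  proof (cases "n \<le> length \<beta>")
    case True
    then show ?thesis by (rule good_consistent[OF \<beta>])
  next
    case False
    then obtain i where i: "n = length \<beta> + Suc i" by (auto dest!: less_imp_Suc_add simp: not_le)
    have s: "suffix (length \<beta>) ?w = f" by (rule suffix_conc_length)
    have 1: "cut ?w n = length \<beta>"
      using cut_suffix[OF cut, of "Suc i"] unfolding s i cut_path[OF f] by (simp only: add_0_right)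
    have "subsequence ?w (length \<beta>) n = subsequence (suffix (length \<beta>) ?w) 0 (Suc i)"
      unfolding subsequence_shift i by (simp only: add_0_right)
    then have "subsequence ?w (length \<beta>) n \<in> T" using path_tree[OF f, of "Suc i"] unfolding s by (simp only:)
    then show ?thesis unfolding consistent_def 1 using i by (simp only:) simp
  qed
  moreover have "?w \<in> cantor"
    using \<beta> f by (auto simp: good_def cantor_def paths_def in_lists_conv_set)
  ultimately show ?thesis unfolding diagonal_def by blast
qed

text \<open>With a first leaf longer than \<open>b\<close>, all indices below \<open>b\<close> stay
  admissible. A successful reduction on \<open>\<beta> \<frown> f\<close> then gives each base a
  further step, and an infinite chain arises.\<close>

lemma not_finite_reducible_diagonal: "\<not> reducible finite_one_computable (paths T) diagonal"
proof
  assume "reducible finite_one_computable (paths T) diagonal"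
  then obtain \<Gamma> b where \<Gamma>: "diagonal \<subseteq> dom \<Gamma>" "\<forall>g\<in>diagonal. the (\<Gamma> g) \<in> paths T"
    and b: "\<forall>g\<in>dom \<Gamma>. \<exists>e<b. \<Gamma> g = Phi e g"
    unfolding reducible_def finite_one_computable_def by blast
  have Phi: "\<exists>e<b. \<exists>h\<in>paths T. Phi e g = Some h" if "g \<in> diagonal" for g
  proof -
    obtain h where h: "\<Gamma> g = Some h" using \<Gamma>(1) \<open>g \<in> diagonal\<close> by blast
    then obtain e where "e < b" "Phi e g = Some h" using b by (metis domI)
    moreover have "h \<in> paths T" using \<Gamma>(2) \<open>g \<in> diagonal\<close> h by force
    ultimately show ?thesis by blast
  qed
  let ?P = "\<lambda>_ \<beta>. good \<beta> \<and> (\<forall>e<b. cut (\<beta> \<frown> (\<lambda>_. 0)) e = 0)"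
  obtain f where f: "f \<in> paths T" using ex_path by blast
  have "\<exists>\<gamma>. \<forall>n. ?P n (\<gamma> n) \<and> step (\<gamma> n) (\<gamma> (Suc n))"
  proof (rule dependent_nat_choice)
    \<comment> \<open>A leaf above a prefix of length \<open>Suc b\<close> is longer than
      \<open>b\<close> and serves as the first leaf.\<close>
    obtain \<tau> where \<tau>: "f [0 \<rightarrow> Suc b] @ \<tau> \<in> leaves T"
      using leaf_above[OF path_tree[OF f]] by blast
    then show "\<exists>\<beta>. good \<beta> \<and> (\<forall>e<b. cut (\<beta> \<frown> (\<lambda>_. 0)) e = 0)"
      using good_leaf cut_leaf(1)[OF \<tau>] by (intro exI[of _ "f [0 \<rightarrow> Suc b] @ \<tau>"]) simp
  next
    fix \<beta> :: "nat list" and n :: nat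
    assume \<beta>: "good \<beta> \<and> (\<forall>e<b. cut (\<beta> \<frown> (\<lambda>_. 0)) e = 0)"
    \<comment> \<open>The end of \<open>\<beta>\<close> is a positive cut, and no index below
      \<open>b\<close> has one.\<close>
    have len: "e < length \<beta>" if "e < b" for e
    proof (rule ccontr)
      assume "\<not> e < length \<beta>"
      then have "length \<beta> \<le> cut (\<beta> \<frown> (\<lambda>_. 0)) e"
        using cut_mono[of "length \<beta>" e "\<beta> \<frown> (\<lambda>_. 0)"] \<beta> by (simp add: good_def)
      then show False using \<beta> that by (simp add: good_def)
    qed
    obtain e h where e: "e < b" "h \<in> paths T" "Phi e (\<beta> \<frown> f) = Some h"
      using Phi[OF good_path] \<beta> f by blast
    obtain m where m: "\<And>\<upsilon>. agree T e (length \<beta>) ((\<beta> \<frown> f) [0 \<rightarrow> m] @ \<upsilon>)"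
      using agree_complete[OF e(3) path_tree[OF e(2)]] by blast
    obtain \<tau> where \<tau>: "f [0 \<rightarrow> m] @ \<tau> \<in> leaves T"
      using leaf_above[OF path_tree[OF f]] by blast
    \<comment> \<open>The \<open>m\<close> entries used by the computation lie within
      \<open>\<beta> @ f [0 \<rightarrow> m]\<close>, so continuing from there to a leaf leaves it
      intact.\<close>
    have "\<beta> @ f [0 \<rightarrow> m] = (\<beta> \<frown> f) [0 \<rightarrow> length \<beta> + m]" by simp
    also have "\<dots> = (\<beta> \<frown> f) [0 \<rightarrow> m] @ subsequence (\<beta> \<frown> f) m (length \<beta> + m)"
      by (rule prefix_le) simp
    finally have "agree T e (length \<beta>) (\<beta> @ f [0 \<rightarrow> m] @ \<tau>)"
      using m[of "subsequence (\<beta> \<frown> f) m (length \<beta> + m) @ \<tau>"] by (metis append.assoc)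
    then have "extends \<beta> (\<beta> @ f [0 \<rightarrow> m] @ \<tau>)"
      unfolding extends_def using \<tau> len[OF e(1)] e(1) \<beta> by auto
    then obtain \<tau>' where step: "step \<beta> \<tau>'" using ex_step by blast
    moreover have "cut (\<tau>' \<frown> (\<lambda>_. 0)) e = 0" if "e < b" for e
    proof -
      obtain \<rho> where "\<tau>' = \<beta> @ \<rho>" using step_append[OF step] by blast
      then have "cut (\<tau>' \<frown> (\<lambda>_. 0)) e = cut (\<beta> \<frown> (\<lambda>_. 0)) e"
        using len[OF that] by (intro cut_cong) (simp add: nth_append)
      then show ?thesis using \<beta> that by simp
    qed
    ultimately show "\<exists>\<tau>. (good \<tau> \<and> (\<forall>e<b. cut (\<tau> \<frown> (\<lambda>_. 0)) e = 0)) \<and> step \<beta> \<tau>"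
      using good_step \<beta> by blast
  qed
  then obtain \<gamma> where \<gamma>: "\<And>n. good (\<gamma> n)" "\<And>n. step (\<gamma> n) (\<gamma> (Suc n))" by blast
  show False using no_infinite_chain[of \<gamma>] \<gamma> by (simp add: good_def)
qed

end

subsection \<open>Reductions\<close>

lemma reducible_antimono: "reducible C A B' \<Longrightarrow> B \<subseteq> B' \<Longrightarrow> reducible C A B"
  unfolding reducible_def by blast

lemma Phi_Oracle: "Phi (godel Oracle) g = Some g"
  by (simp add: Phi_def)

lemma finite_reducible_subset: "B \<subseteq> A \<Longrightarrow> reducible finite_one_computable A B"
  unfolding reducible_def finite_one_computable_def
proof (intro exI[of _ Some] conjI)
  show "\<exists>b. \<forall>g\<in>dom Some. \<exists>e<b. Some g = Phi e g"
    using Phi_Oracle by (metis lessI)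
qed auto

lemma omega_reducible_subset:
  assumes "B \<subseteq> A"
  shows "reducible one_omega_computable A B"
proof -
  have "one_omega_computable Some"
    unfolding one_omega_computable_def computable_on_strings_def
    using Phi_Oracle by (intro exI[of _ "\<lambda>_. godel Oracle"]) (auto intro: computable_const)
  then show ?thesis using assms unfolding reducible_def by (intro exI[of _ Some]) auto
qed

text \<open>Recursion on \<open>k\<close> makes the index computable from \<open>k\<close>, as the
  learner has to output it.\<close>

primrec shift_prog :: "nat \<Rightarrow> prog" where
  "shift_prog 0 = Oracle"
| "shift_prog (Suc k) = Comp (shift_prog k) Succ"

lemma eval_shift_prog: "eval g (shift_prog k) n = Some (g (k + n))"
  by (induction k arbitrary: n) simp_all

lemma Phi_shift_prog: "Phi (godel (shift_prog k)) g = Some (suffix k g)"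
  by (simp add: Phi_def eval_shift_prog suffix_def)

lemma computable_godel_shift_prog:
  assumes "computable k"
  shows "computable (\<lambda>x. godel (shift_prog (k x)))"
proof -
  \<comment> \<open>The code of \<open>Oracle\<close> is 4, that of \<open>Succ\<close> is 1, and
    \<open>6 + 4 * _\<close> codes \<open>Comp\<close>.\<close>
  have "computable (\<lambda>x. rec_nat 4 (\<lambda>_ c. 6 + 4 * prod_encode (c, 1)) (k x))"
    by (intro computable_intros assms)
  moreover have "rec_nat 4 (\<lambda>_ c. 6 + 4 * prod_encode (c, 1)) n = godel (shift_prog n)" for n
    by (induction n) simp_all
  ultimately show ?thesis by (simp only:)
qed

lemma (in special_tree) omega_reducible_nabla: "reducible one_omega_computable (paths T) (nabla T)"
proof -
  have "\<forall>g\<in>nabla T. \<exists>r. suffix r g \<in> paths T \<and> (\<forall>n\<ge>r. cut g n = r)"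
    using nabla_cut by metis
  then obtain R where R: "\<And>g. g \<in> nabla T \<Longrightarrow> suffix (R g) g \<in> paths T"
    "\<And>g n. g \<in> nabla T \<Longrightarrow> R g \<le> n \<Longrightarrow> cut g n = R g" by metis
  \<comment> \<open>The guess takes the last cut seen for the final one; the parse stops at the end
    of the string and reads no padding.\<close>
  define \<Psi> where "\<Psi> \<sigma> = godel (shift_prog (cut (\<sigma> \<frown> (\<lambda>_. 0)) (length \<sigma>)))" for \<sigma>
  define \<Gamma> where "\<Gamma> g = (if g \<in> nabla T then Some (suffix (R g) g) else None)" for g
  have "one_omega_computable \<Gamma>"
    unfolding one_omega_computable_def
  proof (intro exI[of _ \<Psi>] conjI ballI)
    show "computable_on_strings \<Psi>"
      unfolding computable_on_strings_def \<Psi>_def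
      by (intro computable_godel_shift_prog computable_intros)
    fix g assume "g \<in> dom \<Gamma>"
    then have g: "g \<in> nabla T" by (auto simp: \<Gamma>_def split: if_splits)
    have "\<Psi> (g [0 \<rightarrow> n]) = godel (shift_prog (R g))" if "R g \<le> n" for n
      using R(2)[OF g that] cut_prefix[of n n g] by (simp add: \<Psi>_def)
    then have "(\<lambda>n. \<Psi> (g [0 \<rightarrow> n])) \<longlonglongrightarrow> godel (shift_prog (R g))"
      by (intro tendsto_eventually eventually_sequentiallyI)
    then show "\<exists>e. (\<lambda>n. \<Psi> (g [0 \<rightarrow> n])) \<longlonglongrightarrow> e \<and> Phi e g = \<Gamma> g"
      using g by (intro exI[of _ "godel (shift_prog (R g))"]) (simp add: Phi_shift_prog \<Gamma>_def)
  qed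
  moreover have "nabla T \<subseteq> dom \<Gamma>" by (auto simp: \<Gamma>_def)
  moreover have "\<forall>g\<in>nabla T. the (\<Gamma> g) \<in> paths T" using R(1) by (simp add: \<Gamma>_def)
  ultimately show ?thesis unfolding reducible_def by blast
qed

text \<open>Irreducibility passes upwards from \<open>diagonal\<close> and the learner passes
  downwards from \<open>nabla T\<close>, so both ends of the interval are covered at once.\<close>

lemma (in special_tree) degrees_between:
  assumes "diagonal \<subseteq> Q" "Q \<subseteq> nabla T"
  shows "strictly_reducible finite_one_computable Q (paths T)"
    and "equi_reducible one_omega_computable (paths T) Q"
proof -
  have sub: "paths T \<subseteq> Q" using paths_subset_diagonal assms(1) by blast
  show "strictly_reducible finite_one_computable Q (paths T)"
    unfolding strictly_reducible_def
    using finite_reducible_subset[OF sub] not_finite_reducible_diagonal reducible_antimono[OF _ assms(1)]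
    by blast
  show "equi_reducible one_omega_computable (paths T) Q"
    unfolding equi_reducible_def
    using omega_reducible_subset[OF sub] reducible_antimono[OF omega_reducible_nabla assms(2)] by blast
qed

theorem corollary52:
  shows "(\<forall>P T. pi01 P \<and> special P \<and> computable_tree T \<and> paths T = P \<longrightarrow>
            strictly_reducible finite_one_computable (nabla T) P \<and>
            equi_reducible one_omega_computable P (nabla T)) \<and>
         (\<forall>P. pi01 P \<and> special P \<longrightarrow>
            (\<exists>Q. pi01 Q \<and>
               strictly_reducible finite_one_computable Q P \<and>
               equi_reducible one_omega_computable P Q))"
proof (intro conjI allI impI; elim conjE)
  fix P T assume "special P" "computable_tree T" and P: "paths T = P"
  then interpret special_tree T by unfold_locales simp_all
  show "strictly_reducible finite_one_computable (nabla T) P"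
    "equi_reducible one_omega_computable P (nabla T)"
    using degrees_between[OF diagonal_subset_nabla order.refl] unfolding P by blast+
next
  fix P assume "pi01 P" and special: "special P"
  then obtain T where "computable_tree T" and P: "paths T = P" unfolding pi01_def by blast
  then interpret special_tree T using special by unfold_locales simp_all
  show "\<exists>Q. pi01 Q \<and> strictly_reducible finite_one_computable Q P \<and>
      equi_reducible one_omega_computable P Q"
    using pi01_diagonal degrees_between[OF order.refl diagonal_subset_nabla] unfolding P by blast
qed

end
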